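(* Let $\mathfrak{A}$ be a real normed division algebra of real dimension $\beta\in\{1,2,4,8\}$, let $n\ge m\ge 1$ be integers, let $\boldsymbol{\Sigma}\in\mathfrak{P}_m^{\beta}$, $\boldsymbol{\Theta}\in\mathfrak{P}_n^{\beta}$, $\boldsymbol{\mu}\in\mathfrak{L}^{\beta}_{n,m}$ and $\kappa=(k_1,\dots,k_m)\in\mathbb{R}^m$. Let $\mathbf{Z}$ be a random $n\times m$ matrix over $\mathfrak{A}$ and define $\mathbf{X}=\boldsymbol{\mu}+\mathcal{U}(\boldsymbol{\Theta})^{*}\,\mathbf{Z}\,\mathcal{U}(\boldsymbol{\Sigma})$. 1. If $\mathrm{Re}(n\beta/2)>(m-1)\beta/2-k_m$ and $\mathbf{Z}$ has the spherical Kotz-Riesz distribution of type I with parameter $\kappa$, then $\mathbf{X}$ has density, with respect to Lebesgue measure $(d\mathbf{X})$, $$\frac{\beta^{mn\beta/2+\sum_{i=1}^{m}k_i}\,\Gamma_m^{\beta}[n\beta/2]}{\pi^{mn\beta/2}\,\Gamma_m^{\beta}[n\beta/2,\kappa]\,|\boldsymbol{\Sigma}|^{n\beta/2}|\boldsymbol{\Theta}|^{m\beta/2}}\exp\left\{-\beta\,\mathrm{tr}\left[\boldsymbol{\Sigma}^{-1}(\mathbf{X}-\boldsymbol{\mu})^{*}\boldsymbol{\Theta}^{-1}(\mathbf{X}-\boldsymbol{\mu})\right]\right\}\, q_{\kappa}\left[\mathcal{U}(\boldsymbol{\Sigma})^{*-1}(\mathbf{X}-\boldsymbol{\mu})^{*}\boldsymbol{\Theta}^{-1}(\mathbf{X}-\boldsymbol{\mu})\,\mathcal{U}(\boldsymbol{\Sigma})^{-1}\right]$$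 for $\mathbf{X}\in\mathfrak{L}^{\beta}_{n,m}$. 2. If $\mathrm{Re}(n\beta/2)>(m-1)\beta/2+k_1$ and $\mathbf{Z}$ has the spherical Kotz-Riesz distribution of type II with parameter $\kappa$, then $\mathbf{X}$ has density, with respect to Lebesgue measure $(d\mathbf{X})$, $$\frac{\beta^{mn\beta/2-\sum_{i=1}^{m}k_i}\,\Gamma_m^{\beta}[n\beta/2]}{\pi^{mn\beta/2}\,\Gamma_m^{\beta}[n\beta/2,-\kappa]\,|\boldsymbol{\Sigma}|^{n\beta/2}|\boldsymbol{\Theta}|^{m\beta/2}}\exp\left\{-\beta\,\mathrm{tr}\left[\boldsymbol{\Sigma}^{-1}(\mathbf{X}-\boldsymbol{\mu})^{*}\boldsymbol{\Theta}^{-1}(\mathbf{X}-\boldsymbol{\mu})\right]\right\}\, q_{\kappa}\left[\left(\mathcal{U}(\boldsymbol{\Sigma})^{*-1}(\mathbf{X}-\boldsymbol{\mu})^{*}\boldsymbol{\Theta}^{-1}(\mathbf{X}-\boldsymbol{\mu})\,\mathcal{U}(\boldsymbol{\Sigma})^{-1}\right)^{-1}\right]$$ for $\mathbf{X}\in\mathfrak{L}^{\beta}_{n,m}$.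
   Context: The real normed division algebras $\mathfrak{A}$ are the reals, complex numbers, quaternions and octonions, of real dimension $\beta=1,2,4,8$ respectively. $\mathfrak{A}^{n\times m}$ is the set of $n\times m$ matrices over $\mathfrak{A}$, $\mathbf{A}^{*}$ is the conjugate transpose, and $(d\mathbf{X})$ is Lebesgue measure on $\mathfrak{A}^{n\times m}\cong\mathbb{R}^{\beta mn}$. $\mathfrak{L}^{\beta}_{n,m}$ is the set of $n\times m$ matrices over $\mathfrak{A}$ of rank $m\le n$ with $m$ distinct positive singular values. $\mathfrak{S}_m^{\beta}$ is the real vector space of $m\times m$ matrices $\mathbf{S}$ over $\mathfrak{A}$ with $\mathbf{S}=\mathbf{S}^{*}$, with Lebesgue measure $(d\mathbf{S})=\bigwedge_i ds_{ii}\bigwedge_{i<j}\bigwedge_{k=1}^{\beta}ds_{ij}^{(k)}$, and $\mathfrak{P}_m^{\beta}\subset\mathfrak{S}_m^{\beta}$ is the cone of positive definite matrices. $|\cdot|$ denotes the determinant; $\mathrm{tr}$ denotes the trace (its real part, where the trace of a product is not real). For $\mathbf{B}$ positive definite, $\mathcal{U}(\mathbf{B})$ denotes the upper triangular matrix (with positive diagonal) in the Cholesky decomposition $\mathbf{B}=\mathcal{U}(\mathbf{B})^{*}\,\mathcal{U}(\mathbf{B})$, and $\mathcal{U}(\mathbf{B})^{*-1}=(\mathcal{U}(\mathbf{B})^{*})^{-1}$. For $\kappa=(k_1,\dots,k_m)\in\mathbb{R}^m$ and $\mathbf{A}\in\mathfrak{P}_m^{\beta}$, the highest weight vector (generalised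 power) is $$q_{\kappa}(\mathbf{A})=|\mathbf{A}_m|^{k_m}\prod_{i=1}^{m-1}|\mathbf{A}_i|^{k_i-k_{i+1}},\qquad \mathbf{A}_p=(a_{rs})_{1\le r,s\le p}.$$ Gamma functions: $\Gamma_m^{\beta}[a]=\int_{\mathfrak{P}_m^{\beta}}e^{-\mathrm{tr}\,\mathbf{A}}|\mathbf{A}|^{a-(m-1)\beta/2-1}(d\mathbf{A})=\pi^{m(m-1)\beta/4}\prod_{i=1}^m\Gamma[a-(i-1)\beta/2]$; $\Gamma_m^{\beta}[a,\kappa]=\int_{\mathfrak{P}_m^{\beta}}e^{-\mathrm{tr}\,\mathbf{A}}|\mathbf{A}|^{a-(m-1)\beta/2-1}q_{\kappa}(\mathbf{A})(d\mathbf{A})=\pi^{m(m-1)\beta/4}\prod_{i=1}^m\Gamma[a+k_i-(i-1)\beta/2]$; $\Gamma_m^{\beta}[a,-\kappa]=\int_{\mathfrak{P}_m^{\beta}}e^{-\mathrm{tr}\,\mathbf{A}}|\mathbf{A}|^{a-(m-1)\beta/2-1}q_{\kappa}(\mathbf{A}^{-1})(d\mathbf{A})=\pi^{m(m-1)\beta/4}\prod_{i=1}^m\Gamma[a-k_i-(m-i)\beta/2]$ (here "$-\kappa$" is part of the notation, and this is not $\Gamma_m^\beta[a,\cdot]$ evaluated at the vector $-\kappa$). Spherical Kotz-Riesz distributions: $\mathbf{Z}$ has the spherical Kotz-Riesz distribution of type I with parameter $\kappa$, written $\mathbf{Z}\sim\mathcal{K}\mathfrak{R}^{\beta,I}_{n\times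 m}(\kappa,\mathbf{0},\mathbf{I}_n,\mathbf{I}_m)$, if its density is $$\frac{\beta^{mn\beta/2}\Gamma_m^{\beta}[n\beta/2]}{\pi^{mn\beta/2}\Gamma_m^{\beta}[n\beta/2,\kappa]}\exp\{-\beta\,\mathrm{tr}\,\mathbf{Z}^{*}\mathbf{Z}\}\,q_{\kappa}[\beta\mathbf{Z}^{*}\mathbf{Z}]\,(d\mathbf{Z}),\quad \mathbf{Z}\in\mathfrak{L}^{\beta}_{n,m},\ \mathrm{Re}(n\beta/2)>(m-1)\beta/2-k_m.$$ It has the spherical Kotz-Riesz distribution of type II with parameter $\kappa$, written $\mathbf{Z}\sim\mathcal{K}\mathfrak{R}^{\beta,II}_{n\times m}(\kappa,\mathbf{0},\mathbf{I}_n,\mathbf{I}_m)$, if its density is $$\frac{\beta^{mn\beta/2}\Gamma_m^{\beta}[n\beta/2]}{\pi^{mn\beta/2}\Gamma_m^{\beta}[n\beta/2,-\kappa]}\exp\{-\beta\,\mathrm{tr}\,\mathbf{Z}^{*}\mathbf{Z}\}\,q_{\kappa}[(\beta\mathbf{Z}^{*}\mathbf{Z})^{-1}]\,(d\mathbf{Z}),\quad \mathbf{Z}\in\mathfrak{L}^{\beta}_{n,m},\ \mathrm{Re}(n\beta/2)>(m-1)\beta/2+k_1.$$ The distribution of $\mathbf{X}$ in the claim is what the paper calls the (elliptical) Kotz-Riesz distribution of type I, respectively type II, written $\mathcal{K}\mathfrak{R}^{\beta,I}_{n\times m}(\kappa,\boldsymbol{\mu},\boldsymbol{\Theta},\boldsymbol{\Sigma})$,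 respectively $\mathcal{K}\mathfrak{R}^{\beta,II}_{n\times m}(\kappa,\boldsymbol{\mu},\boldsymbol{\Theta},\boldsymbol{\Sigma})$.
   Formalization: For octonions, where the products are ambiguous and the trace formula can fail, X=μ+(U(Θ)*Z)U(Σ), the arguments of tr and q_κ are both W*W with W=U(Θ)*⁻¹((X−μ)U(Σ)⁻¹), positive definite means having a Cholesky decomposition, and the inverse inside q_κ is the Jordan inverse. *)

theory Defs
  imports "HOL-Probability.Probability"
begin

text \<open>
  Real normed division algebras: finite-dimensional unital real algebras, not assumed associative or
  commutative, with a multiplicative Euclidean norm. By Hurwitz's theorem these are exactly the
  reals, the complex numbers, the quaternions and the octonions, so \<open>DIM('a)\<close>, which is the
  parameter \<open>\<beta>\<close>, ranges over 1, 2, 4 and 8.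
\<close>

class normed_division_algebra = euclidean_space + times + one +
  assumes nda_add_left: "(x + y) * z = x * z + y * z"
    and nda_add_right: "x * (y + z) = x * y + x * z"
    and nda_scaleR_left: "(r *\<^sub>R x) * y = r *\<^sub>R (x * y)"
    and nda_scaleR_right: "x * (r *\<^sub>R y) = r *\<^sub>R (x * y)"
    and nda_one_left: "1 * x = x"
    and nda_one_right: "x * 1 = x"
    and nda_norm_mult: "norm (x * y) = norm x * norm y"

instance real :: normed_division_algebra
  by standard (simp_all add: algebra_simps abs_mult)

instance complex :: normed_division_algebra
  by standard (simp_all add: algebra_simps norm_mult)

definition associative_algebra :: "'a::normed_division_algebra itself \<Rightarrow> bool" where
  "associative_algebra _ \<longleftrightarrow> (\<forall>x y z::'a. (x * y) * z = x * (y * z))"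

definition nda_Re :: "'a::normed_division_algebra \<Rightarrow> real" where
  "nda_Re x = inner x 1"

definition nda_cnj :: "'a::normed_division_algebra \<Rightarrow> 'a" where
  "nda_cnj x = (2 * nda_Re x) *\<^sub>R 1 - x"

lemma nda_cnj_real [simp]: "nda_cnj (x::real) = x"
  by (simp add: nda_cnj_def nda_Re_def)

lemma nda_cnj_complex [simp]: "nda_cnj (z::complex) = cnj z"
  by (simp add: nda_cnj_def nda_Re_def complex_eq_iff inner_complex_def)


section \<open>Matrices\<close>

text \<open>
  \<open>'a ^ 'm ^ 'n\<close> is the space of matrices with \<open>CARD('n)\<close> rows and \<open>CARD('m)\<close> columns;
  \<open>lborel\<close> on it is \<open>(dX)\<close>. The library's \<open>**\<close> is not available because it needs a semiring.
\<close>

definition mmul :: "'a::normed_division_algebra ^ 'k ^ 'n \<Rightarrow> 'a ^ 'm ^ 'k \<Rightarrow> 'a ^ 'm ^ 'n"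
    (infixl \<open>\<star>\<close> 70) where
  "A \<star> B = (\<chi> i j. \<Sum>k\<in>UNIV. A $ i $ k * B $ k $ j)"

definition mvec :: "'a::normed_division_algebra ^ 'm ^ 'n \<Rightarrow> 'a ^ 'm \<Rightarrow> 'a ^ 'n" where
  "mvec A v = (\<chi> i. \<Sum>j\<in>UNIV. A $ i $ j * v $ j)"

definition mstar :: "'a::normed_division_algebra ^ 'm ^ 'n \<Rightarrow> 'a ^ 'n ^ 'm" where
  "mstar A = (\<chi> i j. nda_cnj (A $ j $ i))"

definition mone :: "'a::normed_division_algebra ^ 'n ^ 'n" where
  "mone = (\<chi> i j. if i = j then 1 else 0)"

definition mtrace :: "'a::normed_division_algebra ^ 'n ^ 'n \<Rightarrow> real" where
  "mtrace A = nda_Re (\<Sum>i\<in>UNIV. A $ i $ i)"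

text \<open>
  Over the octonions a matrix need not have a two-sided inverse for the matrix product. There
  \<open>A\<inverse>\<close> is the inverse of a Hermitian matrix for the Jordan product \<open>(AB + BA)/2\<close>, which
  is the inverse in the Albert algebra for order 3.
\<close>

definition is_minv ::
    "'a::normed_division_algebra ^ 'n ^ 'n \<Rightarrow> 'a ^ 'n ^ 'n \<Rightarrow> bool" where
  "is_minv A B \<longleftrightarrow>
     (if associative_algebra TYPE('a) then A \<star> B = mone \<and> B \<star> A = mone
      else mstar B = B \<and> A \<star> B + B \<star> A = 2 *\<^sub>R mone)"

definition minv :: "'a::normed_division_algebra ^ 'n ^ 'n \<Rightarrow> 'a ^ 'n ^ 'n" where
  "minv A = (if \<exists>!B. is_minv A B then THE B. is_minv A B else 0)"

definition upper_pos ::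
    "'a::normed_division_algebra ^ 'n::{finite,wellorder} ^ 'n::{finite,wellorder} \<Rightarrow>
     bool" where
  "upper_pos U \<longleftrightarrow> (\<forall>i j. j < i \<longrightarrow> U $ i $ j = 0) \<and> (\<forall>i. \<exists>r>0. U $ i $ i = r *\<^sub>R 1)"

definition chol ::
    "'a::normed_division_algebra ^ 'n::{finite,wellorder} ^ 'n::{finite,wellorder} \<Rightarrow>
     'a ^ 'n::{finite,wellorder} ^ 'n::{finite,wellorder}" where
  "chol B = (THE U. upper_pos U \<and> B = mstar U \<star> U)"

text \<open>
  The cone of positive definite matrices. The quadratic form \<open>x* A x\<close> is real when the product is
  associative. Over the octonions it is ambiguous, and the cone consists of the matrices that have
  a Cholesky decomposition; for order at most 3 this is the symmetric cone of the Euclidean Jordan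
  algebra of Hermitian octonionic matrices.
\<close>

definition pos_def_cone ::
    "('a::normed_division_algebra ^ 'n::{finite,wellorder} ^ 'n::{finite,wellorder}) set" where
  "pos_def_cone = {A. mstar A = A \<and>
     (if associative_algebra TYPE('a)
      then \<forall>x. x \<noteq> 0 \<longrightarrow> 0 < nda_Re (\<Sum>i\<in>UNIV. nda_cnj (x $ i) * mvec A x $ i)
      else \<exists>U. upper_pos U \<and> A = mstar U \<star> U)}"

text \<open>
  A singular value of \<open>Z\<close> is a singular value of the map \<open>v \<mapsto> Z v\<close>. An associative algebra
  admits at most \<open>CARD('m)\<close> distinct ones.
\<close>

definition singular_value :: "'a::normed_division_algebra ^ 'm ^ 'n \<Rightarrow> real \<Rightarrow> bool" where
  "singular_value Z s \<longleftrightarrow> 0 \<le> s \<and> (\<exists>v. v \<noteq> 0 \<and> mvec (mstar Z) (mvec Z v) = s\<^sup>2 *\<^sub>R v)"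

definition full_rank_distinct :: "('a::normed_division_algebra ^ 'm ^ 'n) set" where
  "full_rank_distinct = {Z. (\<forall>v. mvec Z v = 0 \<longrightarrow> v = 0) \<and>
     (\<exists>s :: 'm \<Rightarrow> real. inj s \<and> (\<forall>i. 0 < s i \<and> singular_value Z (s i)))}"


section \<open>Determinant and generalised power\<close>

text \<open>
  \<open>hdet is A\<close> is the determinant of the submatrix of the Hermitian matrix \<open>A\<close> with row and column
  indices \<open>is\<close>, by Gaussian elimination (iterated Schur complements, as for the Dieudonne
  determinant). It is meant for positive definite \<open>A\<close>, where no pivot vanishes. There it is the
  usual determinant over the reals and the complex numbers (\<open>mdet_gram_real\<close>,
  \<open>mdet_gram_complex\<close> below), the Moore determinant over the quaternions and, up to order 3, the
  Freudenthal determinant over the octonions.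
\<close>

fun hdet :: "'n list \<Rightarrow> 'a::normed_division_algebra ^ 'n ^ 'n \<Rightarrow> real" where
  "hdet [] A = 1"
| "hdet (i # is) A = nda_Re (A $ i $ i) *
     hdet is (\<chi> j k. A $ j $ k - (1 / nda_Re (A $ i $ i)) *\<^sub>R (A $ j $ i * A $ i $ k))"

definition minor ::
    "nat \<Rightarrow>
     'a::normed_division_algebra ^ 'n::{finite,wellorder} ^ 'n::{finite,wellorder} \<Rightarrow>
     real" where
  "minor p A = hdet (take p (sorted_list_of_set UNIV)) A"

definition mdet ::
    "'a::normed_division_algebra ^ 'n::{finite,wellorder} ^ 'n::{finite,wellorder} \<Rightarrow>
     real" where
  "mdet A = minor CARD('n) A"

text \<open>The entry \<open>k\<^sub>i\<close> of \<open>\<kappa>\<close>, counted from 1 in the order of the index type.\<close>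

definition kap :: "real ^ 'm::{finite,wellorder} \<Rightarrow> nat \<Rightarrow> real" where
  "kap \<kappa> i = \<kappa> $ (sorted_list_of_set UNIV ! (i - 1))"

definition gen_power ::
    "real ^ 'm::{finite,wellorder} \<Rightarrow>
     'a::normed_division_algebra ^ 'm::{finite,wellorder} ^ 'm::{finite,wellorder} \<Rightarrow>
     real" where
  "gen_power \<kappa> A = minor CARD('m) A powr kap \<kappa> CARD('m) *
     (\<Prod>i = 1..<CARD('m). minor i A powr (kap \<kappa> i - kap \<kappa> (i + 1)))"


section \<open>Gamma functions\<close>

text \<open>Lebesgue measure \<open>(dS)\<close> of the Hermitian matrices, as a measure on all square matrices.\<close>

definition herm_lebesgue ::
    "('a::normed_division_algebra ^ 'm::{finite,wellorder} ^ 'm::{finite,wellorder}) measure" where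
  "herm_lebesgue = distr
     ((\<Pi>\<^sub>M i\<in>(UNIV::'m set). (lborel :: real measure)) \<Otimes>\<^sub>M
      (\<Pi>\<^sub>M p\<in>{(i, j :: 'm). i < j}. (lborel :: 'a measure)))
     borel
     (\<lambda>(d, s). \<chi> i j. if i = j then d i *\<^sub>R 1 else if i < j then s (i, j) else nda_cnj (s (j, i)))"

definition gamma_integrand ::
    "real \<Rightarrow>
     'a::normed_division_algebra ^ 'm::{finite,wellorder} ^ 'm::{finite,wellorder} \<Rightarrow>
     real" where
  "gamma_integrand a A =
     exp (- mtrace A) * mdet A powr (a - (real CARD('m) - 1) * real DIM('a) / 2 - 1)"

definition mgamma ::
    "'a::normed_division_algebra itself \<Rightarrow> 'm::{finite,wellorder} itself \<Rightarrow>
     real \<Rightarrow> real" where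
  "mgamma _ _ a =
     (LINT A : (pos_def_cone :: ('a ^ 'm::{finite,wellorder} ^ 'm::{finite,wellorder}) set) | herm_lebesgue. gamma_integrand a A)"

text \<open>\<open>\<Gamma>[a, \<kappa>]\<close> and \<open>\<Gamma>[a, -\<kappa>]\<close>; the latter is not \<open>mgamma_pos\<close> at the vector \<open>- \<kappa>\<close>.\<close>

definition mgamma_pos ::
    "'a::normed_division_algebra itself \<Rightarrow> real \<Rightarrow>
     real ^ 'm::{finite,wellorder} \<Rightarrow> real" where
  "mgamma_pos _ a \<kappa> =
     (LINT A : (pos_def_cone :: ('a ^ 'm::{finite,wellorder} ^ 'm::{finite,wellorder}) set) | herm_lebesgue.
        gamma_integrand a A * gen_power \<kappa> A)"

definition mgamma_neg ::
    "'a::normed_division_algebra itself \<Rightarrow> real \<Rightarrow>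
     real ^ 'm::{finite,wellorder} \<Rightarrow> real" where
  "mgamma_neg _ a \<kappa> =
     (LINT A : (pos_def_cone :: ('a ^ 'm::{finite,wellorder} ^ 'm::{finite,wellorder}) set) | herm_lebesgue.
        gamma_integrand a A * gen_power \<kappa> (minv A))"


section \<open>Spherical Kotz-Riesz distributions\<close>

definition has_density_on ::
    "'w measure \<Rightarrow> ('w \<Rightarrow> 'b::euclidean_space) \<Rightarrow> 'b set \<Rightarrow> ('b \<Rightarrow> real) \<Rightarrow> bool" where
  "has_density_on M Z D f \<longleftrightarrow> distributed M lborel Z (\<lambda>z. ennreal (f z * indicator D z))"

definition spherical_kotz_riesz_I ::
    "'w measure \<Rightarrow> real ^ 'm::{finite,wellorder} \<Rightarrow>
    ('w \<Rightarrow> 'a::normed_division_algebra ^ 'm::{finite,wellorder} ^ 'n) \<Rightarrow>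
     bool" where
  "spherical_kotz_riesz_I M \<kappa> Z \<longleftrightarrow>
     (let \<beta> = real DIM('a); m = real CARD('m); n = real CARD('n) in
      n * \<beta> / 2 > (m - 1) * \<beta> / 2 - kap \<kappa> CARD('m) \<and>
      has_density_on M Z full_rank_distinct (\<lambda>z.
        \<beta> powr (m * n * \<beta> / 2) * mgamma TYPE('a) TYPE('m) (n * \<beta> / 2) /
          (pi powr (m * n * \<beta> / 2) * mgamma_pos TYPE('a) (n * \<beta> / 2) \<kappa>) *
        exp (- \<beta> * mtrace (mstar z \<star> z)) *
        gen_power \<kappa> (\<beta> *\<^sub>R (mstar z \<star> z))))"

definition spherical_kotz_riesz_II ::
    "'w measure \<Rightarrow> real ^ 'm::{finite,wellorder} \<Rightarrow>
    ('w \<Rightarrow> 'a::normed_division_algebra ^ 'm::{finite,wellorder} ^ 'n) \<Rightarrow>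
     bool" where
  "spherical_kotz_riesz_II M \<kappa> Z \<longleftrightarrow>
     (let \<beta> = real DIM('a); m = real CARD('m); n = real CARD('n) in
      n * \<beta> / 2 > (m - 1) * \<beta> / 2 + kap \<kappa> 1 \<and>
      has_density_on M Z full_rank_distinct (\<lambda>z.
        \<beta> powr (m * n * \<beta> / 2) * mgamma TYPE('a) TYPE('m) (n * \<beta> / 2) /
          (pi powr (m * n * \<beta> / 2) * mgamma_neg TYPE('a) (n * \<beta> / 2) \<kappa>) *
        exp (- \<beta> * mtrace (mstar z \<star> z)) *
        gen_power \<kappa> (minv (\<beta> *\<^sub>R (mstar z \<star> z)))))"


section \<open>The quadratic expressions of the elliptical densities\<close>

text \<open>
  \<open>kr_trace_arg \<Theta> \<Sigma> Y\<close> and \<open>kr_power_arg \<Theta> \<Sigma> Y\<close> stand for the products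
  \<open>\<Sigma>\<inverse> Y* \<Theta>\<inverse> Y\<close> and \<open>U(\<Sigma>)*\<inverse> Y* \<Theta>\<inverse> Y U(\<Sigma>)\<inverse>\<close>. Over the
  octonions they depend on the bracketing, and bracketing from the left does not even give a
  Hermitian matrix. There \<open>U(\<Theta>)*\<inverse>\<close> and \<open>U(\<Sigma>)\<inverse>\<close> act by left and right division,
  \<open>\<Theta>\<inverse>\<close> is read as \<open>U(\<Theta>)\<inverse> U(\<Theta>)*\<inverse>\<close>, and the second product is bracketed
  symmetrically as \<open>W* W\<close> with \<open>W = U(\<Theta>)*\<inverse> (Y U(\<Sigma>)\<inverse>)\<close>; the first one is read as
  the same matrix, of which only the real part of the trace is used.
\<close>

definition ldivide :: "'a::normed_division_algebra ^ 'n ^ 'n \<Rightarrow> 'a ^ 'm ^ 'n \<Rightarrow> 'a ^ 'm ^ 'n" where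
  "ldivide A Y = (THE W. A \<star> W = Y)"

definition rdivide :: "'a::normed_division_algebra ^ 'm ^ 'n \<Rightarrow> 'a ^ 'm ^ 'm \<Rightarrow> 'a ^ 'm ^ 'n" where
  "rdivide Y A = (THE W. W \<star> A = Y)"

definition octonionic_gram ::
    "'a::normed_division_algebra ^ 'n::{finite,wellorder} ^ 'n::{finite,wellorder} \<Rightarrow>
     'a ^ 'm::{finite,wellorder} ^ 'm::{finite,wellorder} \<Rightarrow>
     'a ^ 'm::{finite,wellorder} ^ 'n::{finite,wellorder} \<Rightarrow>
     'a ^ 'm::{finite,wellorder} ^ 'm::{finite,wellorder}" where
  "octonionic_gram \<Theta> \<Sigma> Y =
     (let W = ldivide (mstar (chol \<Theta>)) (rdivide Y (chol \<Sigma>)) in mstar W \<star> W)"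

definition kr_trace_arg ::
    "'a::normed_division_algebra ^ 'n::{finite,wellorder} ^ 'n::{finite,wellorder} \<Rightarrow>
     'a ^ 'm::{finite,wellorder} ^ 'm::{finite,wellorder} \<Rightarrow>
     'a ^ 'm::{finite,wellorder} ^ 'n::{finite,wellorder} \<Rightarrow>
     'a ^ 'm::{finite,wellorder} ^ 'm::{finite,wellorder}" where
  "kr_trace_arg \<Theta> \<Sigma> Y =
     (if associative_algebra TYPE('a) then minv \<Sigma> \<star> mstar Y \<star> minv \<Theta> \<star> Y
      else octonionic_gram \<Theta> \<Sigma> Y)"

definition kr_power_arg ::
    "'a::normed_division_algebra ^ 'n::{finite,wellorder} ^ 'n::{finite,wellorder} \<Rightarrow>
     'a ^ 'm::{finite,wellorder} ^ 'm::{finite,wellorder} \<Rightarrow>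
     'a ^ 'm::{finite,wellorder} ^ 'n::{finite,wellorder} \<Rightarrow>
     'a ^ 'm::{finite,wellorder} ^ 'm::{finite,wellorder}" where
  "kr_power_arg \<Theta> \<Sigma> Y =
     (if associative_algebra TYPE('a)
      then minv (mstar (chol \<Sigma>)) \<star> mstar Y \<star> minv \<Theta> \<star> Y \<star> minv (chol \<Sigma>)
      else octonionic_gram \<Theta> \<Sigma> Y)"


section \<open>The determinant over the reals and the complex numbers\<close>

lemma nda_norm_one: "norm (1::'a::normed_division_algebra) = 1"
proof -
  obtain b :: 'a where b: "b \<in> Basis" using nonempty_Basis by blast
  then have "norm b = norm (1::'a) * norm b"
    by (metis nda_norm_mult nda_one_left)
  with b show ?thesis by simp
qed

lemma nda_Re_scaleR_one [simp]: "nda_Re (r *\<^sub>R (1::'a::normed_division_algebra)) = r"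
  by (simp add: nda_Re_def dot_square_norm nda_norm_one)

lemma nda_cnj_scaleR_one [simp]:
  "nda_cnj (r *\<^sub>R (1::'a::normed_division_algebra)) = r *\<^sub>R 1"
  by (simp add: nda_cnj_def flip: scaleR_left_diff_distrib)

lemma nda_zero_left [simp]: "0 * (x::'a::normed_division_algebra) = 0"
  using nda_scaleR_left[of 0 0 x] by simp

lemma nda_zero_right [simp]: "(x::'a::normed_division_algebra) * 0 = 0"
  using nda_scaleR_right[of x 0 0] by simp

lemma nda_cnj_zero [simp]: "nda_cnj (0::'a::normed_division_algebra) = 0"
  by (simp add: nda_cnj_def nda_Re_def)

lemma hdet_gram_list:
  fixes U A :: "'a::normed_division_algebra ^ 'n::{finite,wellorder} ^ 'n::{finite,wellorder}"
  assumes U: "upper_pos U" and "sorted_wrt (<) is"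
    and "\<And>j k. j \<in> set is \<Longrightarrow> k \<in> set is \<Longrightarrow>
           A $ j $ k = (\<Sum>i\<leftarrow>is. nda_cnj (U $ i $ j) * U $ i $ k)"
  shows "hdet is A = (\<Prod>i\<leftarrow>is. (nda_Re (U $ i $ i))\<^sup>2)"
  using assms(2,3)
proof (induction "is" arbitrary: A)
  case (Cons i js)
  obtain r where r: "r > 0" "U $ i $ i = r *\<^sub>R 1"
    using U unfolding upper_pos_def by blast
  have zero: "U $ l $ i = 0" if "l \<in> set js" for l
    using that Cons.prems(1) U by (auto simp: upper_pos_def)
  have sum0: "(\<Sum>l\<leftarrow>js. nda_cnj (U $ l $ j) * U $ l $ k) = 0" if "j = i \<or> k = i" for j k
  proof -
    have "map (\<lambda>l. nda_cnj (U $ l $ j) * U $ l $ k) js = map (\<lambda>l. 0) js"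
      using that zero by (intro map_cong) auto
    then show ?thesis by (metis sum_list_0)
  qed
  have Aii: "A $ i $ i = r\<^sup>2 *\<^sub>R 1"
    using Cons.prems(2)[of i i] sum0 r
    by (simp add: nda_scaleR_left nda_one_left power2_eq_square)
  have Aji: "A $ j $ i = r *\<^sub>R nda_cnj (U $ i $ j)" if "j \<in> set js" for j
    using Cons.prems(2)[of j i] sum0 r that by (simp add: nda_scaleR_right nda_one_right)
  have Aik: "A $ i $ k = r *\<^sub>R U $ i $ k" if "k \<in> set js" for k
    using Cons.prems(2)[of i k] sum0 r that by (simp add: nda_scaleR_left nda_one_left)
  let ?B = "\<chi> j k. A $ j $ k - (1 / nda_Re (A $ i $ i)) *\<^sub>R (A $ j $ i * A $ i $ k)"
  have "?B $ j $ k = (\<Sum>l\<leftarrow>js. nda_cnj (U $ l $ j) * U $ l $ k)"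
    if "j \<in> set js" "k \<in> set js" for j k
    using that r Cons.prems(2)[of j k]
    by (simp add: Aii Aji Aik nda_scaleR_left nda_scaleR_right power2_eq_square)
  with Cons.IH[of ?B] Cons.prems(1)
  have "hdet js ?B = (\<Prod>i\<leftarrow>js. (nda_Re (U $ i $ i))\<^sup>2)" by auto
  then show ?case by (simp add: Aii r)
qed simp

lemma mdet_gram:
  fixes U :: "'a::normed_division_algebra ^ 'n::{finite,wellorder} ^ 'n::{finite,wellorder}"
  assumes "upper_pos U"
  shows "mdet (mstar U \<star> U) = (\<Prod>i\<in>UNIV. (nda_Re (U $ i $ i))\<^sup>2)"
proof -
  let ?l = "sorted_list_of_set (UNIV :: 'n set)"
  have "hdet ?l (mstar U \<star> U) = (\<Prod>i\<leftarrow>?l. (nda_Re (U $ i $ i))\<^sup>2)"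
    by (intro hdet_gram_list assms)
       (simp_all add: mmul_def mstar_def sum_list_distinct_conv_sum_set)
  then show ?thesis
    by (simp add: mdet_def minor_def flip: prod.distinct_set_conv_list)
qed

lemma mdet_gram_real:
  fixes U :: "real ^ 'n::{finite,wellorder} ^ 'n::{finite,wellorder}"
  assumes "upper_pos U"
  shows "mdet (mstar U \<star> U) = det (mstar U \<star> U)"
proof -
  have eq: "mstar U \<star> U = transpose U ** U"
    by (simp add: mmul_def mstar_def matrix_matrix_mult_def transpose_def)
  have "det U = (\<Prod>i\<in>UNIV. U $ i $ i)"
    using assms by (intro det_upperdiagonal) (auto simp: upper_pos_def)
  then show ?thesis
    unfolding mdet_gram[OF assms] unfolding eq
    by (simp add: det_mul power2_eq_square prod.distrib nda_Re_def)
qed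

lemma mdet_gram_complex:
  fixes U :: "complex ^ 'n::{finite,wellorder} ^ 'n::{finite,wellorder}"
  assumes "upper_pos U"
  shows "of_real (mdet (mstar U \<star> U)) = det (mstar U \<star> U)"
proof -
  have eq: "mstar U \<star> U = mstar U ** U"
    by (simp add: mmul_def matrix_matrix_mult_def)
  have diag: "U $ i $ i = of_real (nda_Re (U $ i $ i))" for i
  proof -
    obtain r where "U $ i $ i = r *\<^sub>R 1" using assms unfolding upper_pos_def by blast
    then show ?thesis by (simp add: nda_Re_def complex_eq_iff)
  qed
  have 1: "det U = (\<Prod>i\<in>UNIV. U $ i $ i)"
    using assms by (intro det_upperdiagonal) (auto simp: upper_pos_def)
  have 2: "det (mstar U) = (\<Prod>i\<in>UNIV. mstar U $ i $ i)"
    using assms by (intro det_lowerdiagonal) (auto simp: upper_pos_def mstar_def)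
  have 3: "mstar U $ i $ i = U $ i $ i" for i
    using arg_cong[OF diag[of i], of Im] by (simp add: mstar_def complex_eq_iff)
  show ?thesis
    unfolding mdet_gram[OF assms] unfolding eq det_mul 1 2 3
    by (simp add: power2_eq_square prod.distrib flip: diag)
qed

end

theory Submission
  imports Defs
begin

text \<open>
  The theorem is a change of variables. Write \<open>T z = U(\<Theta>)* z U(\<Sigma>)\<close>, so that \<open>X = \<mu> + T Z\<close>.

  The map \<open>T\<close> is real linear and triangular: in the basis of matrices with a single nonzero entry,
  the entry of \<open>T z\<close> at a position is a positive multiple of the entry of \<open>z\<close> there plus a
  real-linear function of the other entries of \<open>z\<close> weakly above and weakly to the left. Hence \<open>T\<close>
  is bijective and its Jacobian is the product of the diagonal multiples, \<open>|\<Sigma>|\<close> to the power \<open>n\<beta>/2\<close> times \<open>|\<Theta>|\<close> to the power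
  \<open>m\<beta>/2\<close>. The argument covers the octonions, because the diagonal entries of a Cholesky factor are
  real multiples of 1; it is \<open>triangular_multiplication\<close>, which rests on \<open>triangular_map\<close>. With
  \<open>x - \<mu> = T z\<close>, the trace and the argument of the power in the elliptical density become those
  of \<open>z* z\<close> (\<open>kr_args_of_image\<close>). Scaling the argument of the generalised power by \<open>\<beta>\<close> extracts the factor
  \<open>\<beta>\<close> to the power \<open>\<Sum>k\<^sub>i\<close> (\<open>gen_power_scaleR\<close>), or its inverse for type II. The normalising
  constants then agree factor by factor, with the values of the gamma functions as common factors.

  What remains is measure theoretic. The support condition \<open>z \<in> L\<close>, where \<open>L\<close> is the set of full-rank
  matrices with distinct singular values, turns into \<open>x \<in> L\<close>, and not into \<open>x \<in> \<mu> + T(L)\<close>. The two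
  densities agree almost everywhere provided that \<open>L\<close> is a Borel set with null complement
  (\<open>full_rank_distinct_borel\<close>, \<open>full_rank_distinct_conull\<close>). For the second property,
  take a fixed rectangular diagonal matrix \<open>Z\<^sub>0\<close> with distinct positive entries. On each line
  \<open>s \<mapsto> Z\<^sub>0 + s W\<close> only finitely many points leave \<open>L\<close>: the loss of injectivity is an eigenvalue
  condition on \<open>s\<close>, and the loss of distinctness is the vanishing of a polynomial in \<open>s\<close>, a determinant
  formed from the Krylov vectors of the Gram operator. A Borel cone that meets every line through a
  fixed point in a finite set is null, by Fubini's theorem (\<open>null_set_if_finite_line_sections\<close>).

  Moreover the target density must be Borel measurable on all of \<open>L\<close>, including points that do not come
  from \<open>L\<close>, so the generalised power and the inverse have to be measurable on all matrices
  (\<open>borel_measurable_gen_power\<close>, \<open>borel_measurable_minv\<close>).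
\<close>

section \<open>Lebesgue measure under triangular maps, and null sets\<close>

text \<open>
  Integrate over the coordinate \<open>b\<close> first: with the other coordinates fixed, the map is affine in that
  coordinate with slope \<open>1 + g b\<close>.
\<close>

lemma nn_integral_lborel_single_coordinate_map:
  fixes g :: "'b::euclidean_space \<Rightarrow> real" and f :: "'b \<Rightarrow> ennreal"
  assumes g: "linear g" and b: "b \<in> Basis" and c: "1 + g b \<noteq> 0"
    and f[measurable]: "f \<in> borel_measurable borel"
  shows "(\<integral>\<^sup>+x. f x \<partial>lborel) = \<bar>1 + g b\<bar> * (\<integral>\<^sup>+x. f (x + g x *\<^sub>R b) \<partial>lborel)"
proof -
  interpret product_sigma_finite "\<lambda>_::'b. lborel :: real measure"
    by standard
  have [measurable]: "g \<in> borel_measurable borel"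
    using linear_continuous_on[of g UNIV] g by (intro borel_measurable_continuous_onI) (simp add: linear_conv_bounded_linear)
  let ?B = "Basis - {b}"
  let ?P = "\<Pi>\<^sub>M b\<in>?B. (lborel :: real measure)"
  define e where "e = (\<lambda>x::'b\<Rightarrow>real. \<Sum>j\<in>?B. x j *\<^sub>R j)"
  have ins: "insert b ?B = Basis" using b by auto
  have split: "(\<integral>\<^sup>+x. h x \<partial>lborel) = (\<integral>\<^sup>+x. \<integral>\<^sup>+y. h (e x + y *\<^sub>R b) \<partial>lborel \<partial>?P)"
    if [measurable]: "h \<in> borel_measurable borel" for h :: "'b \<Rightarrow> ennreal"
  proof -
    have "(\<integral>\<^sup>+x. h x \<partial>lborel) = (\<integral>\<^sup>+x. h (\<Sum>j\<in>Basis. x j *\<^sub>R j) \<partial>(\<Pi>\<^sub>M b\<in>Basis. lborel))"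
      by (subst lborel_eq) (simp add: nn_integral_distr)
    also have "\<dots> = (\<integral>\<^sup>+x. \<integral>\<^sup>+y. h (\<Sum>j\<in>Basis. (x(b := y)) j *\<^sub>R j) \<partial>lborel \<partial>?P)"
      by (subst ins[symmetric], subst product_nn_integral_insert) (auto simp: ins)
    also have "(\<lambda>x y. h (\<Sum>j\<in>Basis. (x(b := y)) j *\<^sub>R j)) = (\<lambda>x y. h (e x + y *\<^sub>R b))"
      using b by (simp add: e_def sum.remove[of Basis b] add.commute)
    finally show ?thesis .
  qed
  have "(\<integral>\<^sup>+y. f (w + y *\<^sub>R b) \<partial>lborel)
      = \<bar>1 + g b\<bar> * (\<integral>\<^sup>+y. f ((w + y *\<^sub>R b) + g (w + y *\<^sub>R b) *\<^sub>R b) \<partial>lborel)" for w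
  proof -
    have "(w + y *\<^sub>R b) + g (w + y *\<^sub>R b) *\<^sub>R b = w + (g w + (1 + g b) * y) *\<^sub>R b" for y
      using g by (simp add: linear_add linear_cmul algebra_simps)
    then have eq: "(\<lambda>y. f ((w + y *\<^sub>R b) + g (w + y *\<^sub>R b) *\<^sub>R b)) = (\<lambda>y. f (w + (g w + (1 + g b) * y) *\<^sub>R b))"
      by (simp only:)
    show ?thesis unfolding eq
      using nn_integral_real_affine[of "\<lambda>y. f (w + y *\<^sub>R b)" "1 + g b" "g w"] c by simp
  qed
  then show ?thesis
    by (subst (1 2) split) (simp_all add: nn_integral_cmult e_def)
qed

lemma bij_single_coordinate_map:
  fixes g :: "'b::real_vector \<Rightarrow> real"
  assumes g: "linear g" and c: "1 + g b \<noteq> 0"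
  shows "bij (\<lambda>x. x + g x *\<^sub>R b)"
proof (rule bijI')
  show "(x + g x *\<^sub>R b = y + g y *\<^sub>R b) \<longleftrightarrow> x = y" for x y
  proof
    assume eq: "x + g x *\<^sub>R b = y + g y *\<^sub>R b"
    then have "g (x + g x *\<^sub>R b) = g (y + g y *\<^sub>R b)" by simp
    then have "(1 + g b) * g x = (1 + g b) * g y"
      using g by (simp add: linear_add linear_cmul algebra_simps)
    with c eq show "x = y" by simp
  qed simp
  show "\<exists>x. y = x + g x *\<^sub>R b" for y
  proof
    show "y = (y - (g y / (1 + g b)) *\<^sub>R b) + g (y - (g y / (1 + g b)) *\<^sub>R b) *\<^sub>R b"
      using g c by (simp add: linear_diff linear_cmul field_simps flip: scaleR_left_distrib)
  qed
qed

text \<open>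
  The Jacobian of a triangular map is the product of its diagonal entries. The rank \<open>\<rho>\<close> orders the
  basis; ties are allowed, and basis vectors of equal rank do not interact. Such a map is a composition
  of maps that change one coordinate only, each of which is an affine substitution in one real
  variable.
\<close>

lemma triangular_map:
  fixes T :: "'b::euclidean_space \<Rightarrow> 'b" and \<rho> :: "'b \<Rightarrow> nat"
  assumes T: "linear T"
    and tri: "\<And>b b'. b \<in> Basis \<Longrightarrow> b' \<in> Basis \<Longrightarrow> b \<noteq> b' \<Longrightarrow> \<rho> b' \<le> \<rho> b \<Longrightarrow> T b \<bullet> b' = 0"
    and diag: "\<And>b. b \<in> Basis \<Longrightarrow> T b \<bullet> b > 0"
  shows triangular_map_bij: "bij T"
    and nn_integral_lborel_triangular_map: "f \<in> borel_measurable borel \<Longrightarrow>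
      (\<integral>\<^sup>+x. f x \<partial>lborel) = (\<Prod>b\<in>Basis. T b \<bullet> b) * (\<integral>\<^sup>+x. f (T x) \<partial>lborel)"
proof -
  define P where "P S x = x + (\<Sum>b\<in>S. (T x \<bullet> b - x \<bullet> b) *\<^sub>R b)" for S x
  have P_inner: "P S x \<bullet> b = (if b \<in> S then T x \<bullet> b else x \<bullet> b)"
    if "S \<subseteq> Basis" "b \<in> Basis" for S x b
  proof -
    have "(\<Sum>j\<in>S. (T x \<bullet> j - x \<bullet> j) * (j \<bullet> b)) = (\<Sum>j\<in>S. if j = b then T x \<bullet> b - x \<bullet> b else 0)"
      using that by (intro sum.cong) (auto simp: inner_Basis)
    then show ?thesis
      using that finite_subset[OF that(1) finite_Basis]
      by (simp add: P_def inner_add_left inner_sum_left)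
  qed
  have P_meas: "P S \<in> borel_measurable borel" for S
    using T unfolding P_def linear_conv_bounded_linear
    by (intro borel_measurable_continuous_onI continuous_intros linear_continuous_on)
  \<comment> \<open>\<open>P S\<close> applies \<open>T\<close> to the coordinates in \<open>S\<close> only. The coordinate of highest rank is changed
    first, because the new values of the others do not depend on it.\<close>
  have step: "S \<subseteq> Basis \<longrightarrow> bij (P S) \<and> (\<forall>f\<in>borel_measurable borel.
      (\<integral>\<^sup>+x. f x \<partial>lborel) = ennreal (\<Prod>b\<in>S. T b \<bullet> b) * (\<integral>\<^sup>+x. f (P S x) \<partial>lborel))"
    if "finite S" for S
    using that
  proof (induction S rule: finite_ranking_induct[where f = \<rho>])
    case empty
    have "P {} = id" by (simp add: P_def fun_eq_iff)
    then show ?case by (simp del: id_apply) simp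
  next
    case (insert b S)
    show ?case
    proof (cases "b \<in> S")
      case True
      then show ?thesis using insert by (simp add: insert_absorb)
    next
      case False
      show ?thesis
      proof
        assume sub: "insert b S \<subseteq> Basis"
        define g where "g x = T x \<bullet> b - x \<bullet> b" for x
        define E where "E x = x + g x *\<^sub>R b" for x
        have g: "linear g"
          unfolding g_def using T by (auto intro!: linearI simp: linear_add linear_cmul algebra_simps inner_add_left)
        have gb: "1 + g b = T b \<bullet> b" using sub by (simp add: g_def)
        have pos: "T b \<bullet> b > 0" using sub diag by blast
        have comp: "P (insert b S) x = P S (E x)" for x
        proof (rule euclidean_eqI)
          fix j :: 'b assume j: "j \<in> Basis"
          have Ej: "E x \<bullet> j = (if j = b then T x \<bullet> b else x \<bullet> j)"
            using j sub by (auto simp: E_def g_def inner_add_left inner_Basis)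
          have "T (E x) \<bullet> j = T x \<bullet> j" if "j \<in> S"
            using that j sub False insert(2)[of j] tri[of b j] T
            by (auto simp: E_def linear_add linear_cmul inner_add_left)
          then show "P (insert b S) x \<bullet> j = P S (E x) \<bullet> j"
            using P_inner[of S j "E x"] P_inner[of "insert b S" j x] Ej j sub False
            by auto
        qed
        have IH: "bij (P S)" "\<And>f. f \<in> borel_measurable borel \<Longrightarrow>
            (\<integral>\<^sup>+x. f x \<partial>lborel) = ennreal (\<Prod>b\<in>S. T b \<bullet> b) * (\<integral>\<^sup>+x. f (P S x) \<partial>lborel)"
          using insert sub by auto
        have "bij (P S \<circ> E)"
          using IH(1) bij_single_coordinate_map[OF g, of b] gb pos
          unfolding E_def[abs_def] by (intro bij_comp) auto
        moreover have "(\<integral>\<^sup>+x. f x \<partial>lborel)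
            = ennreal (\<Prod>b\<in>insert b S. T b \<bullet> b) * (\<integral>\<^sup>+x. f (P (insert b S) x) \<partial>lborel)"
          if f: "f \<in> borel_measurable borel" for f
        proof -
          have "(\<integral>\<^sup>+x. f (P S x) \<partial>lborel) = \<bar>1 + g b\<bar> * (\<integral>\<^sup>+x. f (P S (E x)) \<partial>lborel)"
            unfolding E_def
            using nn_integral_lborel_single_coordinate_map[OF g, of b "\<lambda>x. f (P S x)"]
              measurable_compose[OF P_meas f] gb pos sub by simp
          then have "(\<integral>\<^sup>+x. f x \<partial>lborel) = ennreal (\<Prod>b\<in>S. T b \<bullet> b) *
              (ennreal (T b \<bullet> b) * (\<integral>\<^sup>+x. f (P S (E x)) \<partial>lborel))"
            using IH(2)[OF f] gb pos by simp
          moreover have "(\<Prod>b\<in>S. T b \<bullet> b) \<ge> 0"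
            using sub diag by (intro prod_nonneg) (auto intro: less_imp_le)
          ultimately show ?thesis
            using False insert(1) pos
            by (simp add: comp ennreal_mult mult_ac)
        qed
        ultimately show "bij (P (insert b S)) \<and> (\<forall>f\<in>borel_measurable borel. (\<integral>\<^sup>+x. f x \<partial>lborel)
            = ennreal (\<Prod>b\<in>insert b S. T b \<bullet> b) * (\<integral>\<^sup>+x. f (P (insert b S) x) \<partial>lborel))"
          by (simp add: comp o_def flip: comp[abs_def])
      qed
    qed
  qed
  have "P Basis = T"
    using P_inner[of Basis] by (auto intro!: ext euclidean_eqI[of "P Basis _"])
  with step[of Basis] show "bij T"
    and "f \<in> borel_measurable borel \<Longrightarrow>
      (\<integral>\<^sup>+x. f x \<partial>lborel) = (\<Prod>b\<in>Basis. T b \<bullet> b) * (\<integral>\<^sup>+x. f (T x) \<partial>lborel)"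
    by auto
qed

text \<open>
  A closed set is a countable union of compact sets, and projections of compact sets are compact. Sets
  defined by an existential quantifier over a closed relation are thereby Borel.
\<close>

lemma projection_of_closed_borel:
  fixes R :: "('b::euclidean_space \<times> 'c::euclidean_space) set"
  assumes "closed R"
  shows "fst ` R \<in> sets borel"
proof -
  have "fst ` R = (\<Union>k::nat. fst ` (R \<inter> cball 0 (real k)))"
  proof -
    have "\<exists>k::nat. p \<in> cball 0 (real k)" for p :: "'b \<times> 'c"
      using real_arch_simple[of "norm p"] by simp
    then show ?thesis by fast
  qed
  moreover have "compact (fst ` (R \<inter> cball 0 (real k)))" for k
    using assms by (intro compact_continuous_image continuous_intros closed_Int_compact) auto
  ultimately show ?thesis
    by (auto intro!: sets.countable_UN simp: borel_compact)
qed

text \<open>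
  Since \<open>S\<close> is a cone, \<open>x + t z \<in> S\<close> is for \<open>t \<noteq> 0\<close> the same as \<open>z + t\<inverse> x \<in> S\<close>, so each line
  in the direction \<open>z\<close> meets \<open>S\<close> in a finite set. Translation invariance writes the measure of
  \<open>S\<close> as an average over the translates of \<open>S\<close> along \<open>z\<close>, and Fubini's theorem evaluates this
  average to 0.
\<close>

lemma null_set_if_finite_line_sections:
  fixes S :: "'b::euclidean_space set"
  assumes S[measurable]: "S \<in> sets borel"
    and cone: "\<And>x c. x \<in> S \<Longrightarrow> c \<noteq> 0 \<Longrightarrow> c *\<^sub>R x \<in> S"
    and fin: "\<And>w. finite {s. z + s *\<^sub>R w \<in> S}"
  shows "S \<in> null_sets lborel"
proof -
  have meas: "(\<lambda>(t, x). indicator {0..1} t * indicator S (x + t *\<^sub>R z) :: ennreal)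
      \<in> borel_measurable (lborel \<Otimes>\<^sub>M lborel)"
    by (simp add: case_prod_beta') measurable
  have trans: "(\<integral>\<^sup>+x. indicator S (x + v) \<partial>lborel) = emeasure lborel S" for v
  proof -
    have "(\<integral>\<^sup>+x. indicator S (x + v) \<partial>lborel) = (\<integral>\<^sup>+x. indicator S x \<partial>distr lborel borel ((+) v))"
      by (subst nn_integral_distr) (auto simp: add.commute)
    then show ?thesis by (simp add: lborel_distr_plus)
  qed
  have zero: "(\<integral>\<^sup>+t. indicator {0..1} t * indicator S (x + t *\<^sub>R z) \<partial>lborel) = 0" for x
  proof -
    have "{t. x + t *\<^sub>R z \<in> S} \<subseteq> insert 0 (inverse ` {s. z + s *\<^sub>R x \<in> S})"
    proof
      fix t assume "t \<in> {t. x + t *\<^sub>R z \<in> S}"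
      then have "inverse t *\<^sub>R (x + t *\<^sub>R z) \<in> S" if "t \<noteq> 0" using cone that by simp
      then have "inverse t \<in> {s. z + s *\<^sub>R x \<in> S}" if "t \<noteq> 0"
        using that by (simp add: scaleR_add_right add.commute)
      then show "t \<in> insert 0 (inverse ` {s. z + s *\<^sub>R x \<in> S})"
        by (metis image_eqI insertCI inverse_inverse_eq)
    qed
    then have "finite {t. x + t *\<^sub>R z \<in> S}"
      using fin[of x] finite_subset by blast
    then have "AE t in lborel. x + t *\<^sub>R z \<notin> S"
      using AE_not_in[OF finite_imp_null_set_lborel, of "{t. x + t *\<^sub>R z \<in> S}"] by simp
    then have "(\<integral>\<^sup>+t. indicator {0..1} t * indicator S (x + t *\<^sub>R z) \<partial>lborel) = (\<integral>\<^sup>+t. 0 \<partial>(lborel :: real measure))"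
      by (intro nn_integral_cong_AE) auto
    then show ?thesis by simp
  qed
  have "emeasure lborel S = (\<integral>\<^sup>+t. indicator {0..1::real} t * emeasure lborel S \<partial>lborel)"
    by (simp add: nn_integral_multc)
  also have "\<dots> = (\<integral>\<^sup>+t. \<integral>\<^sup>+x. indicator {0..1} t * indicator S (x + t *\<^sub>R z) \<partial>lborel \<partial>lborel)"
    by (simp add: nn_integral_cmult trans)
  also have "\<dots> = (\<integral>\<^sup>+x. \<integral>\<^sup>+t. indicator {0..1} t * indicator S (x + t *\<^sub>R z) \<partial>lborel \<partial>lborel)"
    using lborel_pair.Fubini'[OF meas] by simp
  also have "\<dots> = 0" by (simp add: zero)
  finally show ?thesis using S by (intro null_setsI) auto
qed

section \<open>Conjugation and adjoints in a normed division algebra\<close>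

interpretation nda_mult: bounded_bilinear "(*) :: 'a::normed_division_algebra \<Rightarrow> 'a \<Rightarrow> 'a"
proof
  show "\<exists>K. \<forall>a b :: 'a. norm (a * b) \<le> norm a * norm b * K"
    by (intro exI[of _ 1]) (simp add: nda_norm_mult)
qed (simp_all add: nda_add_left nda_add_right nda_scaleR_left nda_scaleR_right)

text \<open>
  Polarisation of the multiplicativity of the norm. This and its mirror image replace associativity in
  what follows.
\<close>

lemma nda_inner_mult_left:
  fixes a :: "'a::normed_division_algebra"
  shows "(a * x) \<bullet> (a * y) = (norm a)\<^sup>2 * (x \<bullet> y)"
proof -
  have "(norm (a * x + a * y))\<^sup>2 = (norm a)\<^sup>2 * (norm (x + y))\<^sup>2"
    by (simp add: nda_norm_mult power_mult_distrib flip: nda_add_right)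
  then show ?thesis
    by (simp add: dot_norm nda_norm_mult power_mult_distrib diff_divide_distrib algebra_simps)
qed

lemma nda_inner_mult_right:
  fixes a :: "'a::normed_division_algebra"
  shows "(x * a) \<bullet> (y * a) = (norm a)\<^sup>2 * (x \<bullet> y)"
proof -
  have "(norm (x * a + y * a))\<^sup>2 = (norm a)\<^sup>2 * (norm (x + y))\<^sup>2"
    by (simp add: nda_norm_mult power_mult_distrib flip: nda_add_left)
  then show ?thesis
    by (simp add: dot_norm nda_norm_mult power_mult_distrib diff_divide_distrib algebra_simps)
qed

lemma nda_inner_one_one: "(1::'a::normed_division_algebra) \<bullet> 1 = 1"
  using nda_norm_one by (simp add: norm_eq_1)

text \<open>
  Left multiplication by the conjugate is the adjoint of left multiplication: expand the polarised norm
  identity for the factor \<open>a + 1\<close>.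
\<close>

lemma nda_inner_cnj_left:
  fixes a :: "'a::normed_division_algebra"
  shows "(nda_cnj a * x) \<bullet> y = x \<bullet> (a * y)"
proof -
  have "((a + 1) * x) \<bullet> ((a + 1) * y) = (norm (a + 1))\<^sup>2 * (x \<bullet> y)"
    by (rule nda_inner_mult_left)
  moreover have "(norm (a + 1))\<^sup>2 = (norm a)\<^sup>2 + 2 * nda_Re a + 1"
    by (simp add: power2_norm_eq_inner nda_Re_def inner_add_left inner_add_right inner_commute
        nda_inner_one_one)
  ultimately have "(a * x) \<bullet> y + x \<bullet> (a * y) = 2 * nda_Re a * (x \<bullet> y)"
    using nda_inner_mult_left[of a x y]
    by (simp add: nda_add_left nda_one_left inner_add_left inner_add_right algebra_simps)
  then show ?thesis
    by (simp add: nda_cnj_def nda_mult.diff_left nda_scaleR_left nda_one_left inner_diff_left)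
qed

lemma nda_inner_cnj_right:
  fixes a :: "'a::normed_division_algebra"
  shows "(x * nda_cnj a) \<bullet> y = x \<bullet> (y * a)"
proof -
  have "(x * (a + 1)) \<bullet> (y * (a + 1)) = (norm (a + 1))\<^sup>2 * (x \<bullet> y)"
    by (rule nda_inner_mult_right)
  moreover have "(norm (a + 1))\<^sup>2 = (norm a)\<^sup>2 + 2 * nda_Re a + 1"
    by (simp add: power2_norm_eq_inner nda_Re_def inner_add_left inner_add_right inner_commute
        nda_inner_one_one)
  ultimately have "(x * a) \<bullet> y + x \<bullet> (y * a) = 2 * nda_Re a * (x \<bullet> y)"
    using nda_inner_mult_right[of x a y]
    by (simp add: nda_add_right nda_one_right inner_add_left inner_add_right algebra_simps)
  then show ?thesis
    by (simp add: nda_cnj_def nda_mult.diff_right nda_scaleR_right nda_one_right inner_diff_left)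
qed

lemma bounded_linear_nda_Re: "bounded_linear nda_Re"
  unfolding nda_Re_def by (rule bounded_linear_inner_left)

lemmas nda_Re_linear =
  linear_add[OF bounded_linear.linear[OF bounded_linear_nda_Re]]
  linear_diff[OF bounded_linear.linear[OF bounded_linear_nda_Re]]
  linear_cmul[OF bounded_linear.linear[OF bounded_linear_nda_Re]]
  linear_sum[OF bounded_linear.linear[OF bounded_linear_nda_Re]]

lemma bounded_linear_nda_cnj: "bounded_linear nda_cnj"
  unfolding nda_cnj_def
  by (intro bounded_linear_sub bounded_linear_ident bounded_linear_scaleR_left[THEN bounded_linear_compose]
      bounded_linear_mult_right[THEN bounded_linear_compose] bounded_linear_nda_Re)

lemmas nda_cnj_linear =
  linear_add[OF bounded_linear.linear[OF bounded_linear_nda_cnj]]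
  linear_diff[OF bounded_linear.linear[OF bounded_linear_nda_cnj]]
  linear_cmul[OF bounded_linear.linear[OF bounded_linear_nda_cnj]]
  linear_sum[OF bounded_linear.linear[OF bounded_linear_nda_cnj]]

lemma nda_Re_one [simp]: "nda_Re 1 = 1"
  by (simp add: nda_Re_def nda_inner_one_one)

lemma nda_Re_cnj [simp]: "nda_Re (nda_cnj x) = nda_Re x"
  by (simp add: nda_cnj_def nda_Re_linear)

lemma nda_cnj_cnj [simp]: "nda_cnj (nda_cnj x) = x"
  by (simp add: nda_cnj_def[of "nda_cnj x"]) (simp add: nda_cnj_def)

text \<open>
  Moving factors across the inner product by adjointness gives both sides the value
  \<open>(nda_cnj x * nda_cnj z) \<bullet> y\<close>, without any reassociation.
\<close>

lemma nda_cnj_mult: "nda_cnj (x * y) = nda_cnj y * nda_cnj (x::'a::normed_division_algebra)"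
proof (rule euclidean_eqI)
  fix z :: 'a
  have "nda_cnj (x * y) \<bullet> z = (nda_cnj (x * y) * 1) \<bullet> z" by (simp add: nda_one_right)
  also have "\<dots> = 1 \<bullet> ((x * y) * z)" by (rule nda_inner_cnj_left)
  also have "\<dots> = (nda_cnj x * nda_cnj z) \<bullet> y"
    using nda_inner_cnj_right[of 1 z "x * y"] nda_inner_cnj_left[of x "nda_cnj z" y]
    by (simp add: nda_one_left)
  also have "\<dots> = (nda_cnj y * nda_cnj x) \<bullet> z"
    using nda_inner_cnj_right[of "nda_cnj x" z y] nda_inner_cnj_left[of y "nda_cnj x" z] by simp
  finally show "nda_cnj (x * y) \<bullet> z = (nda_cnj y * nda_cnj x) \<bullet> z" .
qed

lemma nda_Re_commute: "nda_Re (x * y) = nda_Re (y * (x::'a::normed_division_algebra))"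
  using nda_inner_cnj_left[of "nda_cnj x" y 1] nda_inner_cnj_right[of y "nda_cnj x" 1]
  by (simp add: nda_Re_def nda_one_left nda_one_right)

lemma nda_cnj_mult_self:
  "nda_cnj x * x = (norm x)\<^sup>2 *\<^sub>R (1::'a::normed_division_algebra)"
proof (rule euclidean_eqI)
  fix z :: 'a
  have "(nda_cnj x * x) \<bullet> z = (x * 1) \<bullet> (x * z)" by (simp add: nda_inner_cnj_left nda_one_right)
  then show "(nda_cnj x * x) \<bullet> z = ((norm x)\<^sup>2 *\<^sub>R 1) \<bullet> z"
    by (simp only: nda_inner_mult_left inner_scaleR_left)
qed

text \<open>
  The conjugate transpose is the adjoint for the real inner product, also over the octonions. Thus
  \<open>v \<mapsto> Z* (Z v)\<close> is a self-adjoint real operator, and its spectral theory is available without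
  associativity.
\<close>

lemma inner_mstar:
  "mvec (mstar A) v \<bullet> w = v \<bullet> mvec A w"
proof -
  have "mvec (mstar A) v \<bullet> w = (\<Sum>i\<in>UNIV. \<Sum>j\<in>UNIV. v $ j \<bullet> (A $ j $ i * w $ i))"
    by (simp add: inner_vec_def mvec_def mstar_def inner_sum_left nda_inner_cnj_left)
  also have "\<dots> = v \<bullet> mvec A w"
    by (subst sum.swap) (simp add: inner_vec_def mvec_def inner_sum_right)
  finally show ?thesis .
qed

lemma bilinear_mvec: "bilinear mvec"
  by (auto simp: bilinear_def mvec_def vec_eq_iff nda_add_left nda_add_right nda_scaleR_left
      nda_scaleR_right sum.distrib scaleR_sum_right intro!: linearI)

lemma linear_mstar: "linear mstar"
  by (auto simp: mstar_def vec_eq_iff nda_cnj_linear intro!: linearI)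

lemma bilinear_mmul: "bilinear (\<star>)"
  by (auto simp: bilinear_def mmul_def vec_eq_iff nda_add_left nda_add_right nda_scaleR_left
      nda_scaleR_right sum.distrib scaleR_sum_right intro!: linearI)

lemma mstar_mstar [simp]: "mstar (mstar A) = A"
  by (simp add: mstar_def vec_eq_iff)

lemma mstar_mmul: "mstar (A \<star> B) = mstar B \<star> mstar A"
  by (simp add: mstar_def mmul_def vec_eq_iff nda_cnj_linear nda_cnj_mult)

lemma mtrace_commute:
  fixes A :: "'a::normed_division_algebra ^ 'm ^ 'n"
  shows "mtrace (A \<star> B) = mtrace (B \<star> A)"
proof -
  have "mtrace (A \<star> B) = (\<Sum>i\<in>UNIV. \<Sum>k\<in>UNIV. nda_Re (A $ i $ k * B $ k $ i))"
    by (simp add: mtrace_def mmul_def nda_Re_linear)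
  also have "\<dots> = (\<Sum>k\<in>UNIV. \<Sum>i\<in>UNIV. nda_Re (B $ k $ i * A $ i $ k))"
    by (subst sum.swap) (intro sum.cong refl nda_Re_commute)
  also have "\<dots> = mtrace (B \<star> A)"
    by (simp add: mtrace_def mmul_def nda_Re_linear)
  finally show ?thesis .
qed

lemma mmul_mone [simp]: "A \<star> mone = A"
proof -
  have "(\<Sum>k\<in>UNIV. A $ i $ k * (if k = j then 1 else 0)) = A $ i $ j" for i j
    by (subst sum.remove[of UNIV j]) (simp_all add: nda_one_right)
  then show ?thesis by (simp add: mmul_def mone_def vec_eq_iff)
qed

lemma mone_mmul [simp]: "mone \<star> A = A"
proof -
  have "(\<Sum>k\<in>UNIV. (if i = k then 1 else 0) * A $ k $ j) = A $ i $ j" for i j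
    by (subst sum.remove[of UNIV i]) (simp_all add: nda_one_left)
  then show ?thesis by (simp add: mmul_def mone_def vec_eq_iff)
qed

lemma mmul_assoc:
  fixes A :: "'a::normed_division_algebra ^ 'k ^ 'n"
  assumes "associative_algebra TYPE('a)"
  shows "(A \<star> B) \<star> C = A \<star> (B \<star> C)"
proof -
  have "((A \<star> B) \<star> C) $ i $ j = (A \<star> (B \<star> C)) $ i $ j" for i j
  proof -
    have "((A \<star> B) \<star> C) $ i $ j = (\<Sum>k\<in>UNIV. \<Sum>l\<in>UNIV. (A $ i $ l * B $ l $ k) * C $ k $ j)"
      by (simp add: mmul_def nda_mult.sum_left)
    also have "\<dots> = (\<Sum>l\<in>UNIV. \<Sum>k\<in>UNIV. A $ i $ l * (B $ l $ k * C $ k $ j))"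
      using assms unfolding associative_algebra_def by (subst sum.swap) simp
    also have "\<dots> = (A \<star> (B \<star> C)) $ i $ j"
      by (simp add: mmul_def nda_mult.sum_right)
    finally show ?thesis .
  qed
  then show ?thesis by (simp add: vec_eq_iff)
qed

section \<open>Eigenvalues and Krylov vectors of self-adjoint operators\<close>

text \<open>
  Eigenvectors for distinct eigenvalues are linearly independent.
\<close>

lemma finite_eigenvalues:
  fixes K :: "'b::euclidean_space \<Rightarrow> 'b"
  assumes K: "linear K"
  shows "finite {c. \<exists>v. v \<noteq> 0 \<and> K v = c *\<^sub>R v}" (is "finite ?\<Lambda>")
proof (rule ccontr)
  assume "infinite ?\<Lambda>"
  then obtain S where S: "finite S" "card S = Suc DIM('b)" "S \<subseteq> ?\<Lambda>"
    using infinite_arbitrarily_large by blast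
  then have "\<forall>c\<in>S. \<exists>v. v \<noteq> 0 \<and> K v = c *\<^sub>R v" by blast
  then obtain f where f: "\<And>c. c \<in> S \<Longrightarrow> f c \<noteq> 0" "\<And>c. c \<in> S \<Longrightarrow> K (f c) = c *\<^sub>R f c"
    by metis
  have ind: "\<forall>c\<in>R. a c = 0" if "finite R" "R \<subseteq> S" "(\<Sum>c\<in>R. a c *\<^sub>R f c) = 0" for R a
    using that
  proof (induction R arbitrary: a)
    case (insert d R)
    have eq: "a d *\<^sub>R f d + (\<Sum>c\<in>R. a c *\<^sub>R f c) = 0" using insert by simp
    then have "K (a d *\<^sub>R f d + (\<Sum>c\<in>R. a c *\<^sub>R f c)) = 0" using K by (simp add: linear_0)
    then have "(a d * d) *\<^sub>R f d + (\<Sum>c\<in>R. (a c * c) *\<^sub>R f c) = 0"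
      using K f insert.prems by (simp add: linear_add linear_cmul linear_sum subset_iff)
    moreover have "(a d * d) *\<^sub>R f d + (\<Sum>c\<in>R. (a c * d) *\<^sub>R f c) = 0"
      using arg_cong[OF eq, of "\<lambda>x. d *\<^sub>R x"]
      by (simp add: scaleR_add_right scaleR_sum_right mult.commute)
    ultimately have "(\<Sum>c\<in>R. (a c * c) *\<^sub>R f c) = (\<Sum>c\<in>R. (a c * d) *\<^sub>R f c)"
      by (metis add_left_cancel)
    then have "(\<Sum>c\<in>R. (a c * (c - d)) *\<^sub>R f c) = 0"
      by (simp add: right_diff_distrib scaleR_left_diff_distrib sum_subtractf)
    then have "\<forall>c\<in>R. a c * (c - d) = 0"
      using insert.IH[of "\<lambda>c. a c * (c - d)"] insert.prems by simp
    then have "\<forall>c\<in>R. a c = 0" using insert by auto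
    with eq f insert.prems show ?case by auto
  qed simp
  have inj: "inj_on f S"
  proof (rule inj_onI)
    fix c d assume "c \<in> S" "d \<in> S" "f c = f d"
    then have "c *\<^sub>R f c = d *\<^sub>R f c" using f(2) by metis
    then show "c = d" using f(1) \<open>c \<in> S\<close> by simp
  qed
  have "\<forall>v\<in>f ` S. u v = 0" if "(\<Sum>v\<in>f ` S. u v *\<^sub>R v) = 0" for u
    using ind[of S "\<lambda>c. u (f c)"] that S(1) inj by (simp add: sum.reindex)
  then have "independent (f ` S)"
    using S(1) by (auto simp: dependent_finite)
  then have "card (f ` S) \<le> DIM('b)" using independent_bound by blast
  then show False using S inj by (simp add: card_image)
qed

text \<open>
  The spectral theorem. The orthogonal complement of the eigenvectors is an invariant subspace; if it
  were nonzero, a maximiser of the Rayleigh quotient on its unit sphere would be an eigenvector.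
\<close>

lemma selfadjoint_eigenvectors_span:
  fixes H :: "'b::euclidean_space \<Rightarrow> 'b"
  assumes H: "linear H" and sym: "\<And>x y. H x \<bullet> y = x \<bullet> H y"
  shows "span {v. \<exists>c. H v = c *\<^sub>R v} = UNIV" (is "span ?E = UNIV")
proof (rule ccontr)
  assume "span ?E \<noteq> UNIV"
  then have "dim ?E < DIM('b)"
    by (metis dim_eq_full dim_subset_UNIV le_neq_implies_less)
  then obtain x0 where x0: "x0 \<noteq> 0" "\<And>y. y \<in> span ?E \<Longrightarrow> orthogonal x0 y"
    using orthogonal_to_subspace_exists by blast
  define W where "W = {x. \<forall>y\<in>?E. x \<bullet> y = 0}"
  have W_sub: "subspace W"
    by (auto simp: W_def subspace_def inner_add_left)
  have "W = (\<Inter>y\<in>?E. {x. x \<bullet> y = 0})" by (auto simp: W_def)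
  then have W_closed: "closed W"
    by (auto intro!: closed_Collect_eq continuous_intros)
  have W_inv: "H x \<in> W" if "x \<in> W" for x
    using that by (auto simp: W_def sym)
  have "x0 \<in> W" using x0 by (auto simp: W_def orthogonal_def span_base)
  then have "(1 / norm x0) *\<^sub>R x0 \<in> W \<inter> sphere 0 1"
    using x0 W_sub by (simp add: subspace_scale)
  then have "W \<inter> sphere 0 1 \<noteq> {}" by blast
  moreover have "compact (W \<inter> sphere 0 1)"
    using W_closed by (simp add: closed_Int_compact)
  moreover have "continuous_on (W \<inter> sphere 0 1) (\<lambda>x. H x \<bullet> x)"
    using H by (intro continuous_intros linear_continuous_on) (simp add: linear_conv_bounded_linear)
  ultimately obtain x where "x \<in> W \<inter> sphere 0 1" "\<forall>w\<in>W \<inter> sphere 0 1. H w \<bullet> w \<le> H x \<bullet> x"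
    using continuous_attains_sup[of "W \<inter> sphere 0 1" "\<lambda>x. H x \<bullet> x"] by blast
  then have x: "x \<in> W" "norm x = 1"
    and max: "\<And>w. w \<in> W \<Longrightarrow> norm w = 1 \<Longrightarrow> H w \<bullet> w \<le> H x \<bullet> x"
    by auto
  define c where "c = H x \<bullet> x"
  have nonneg: "0 \<le> c * (w \<bullet> w) - H w \<bullet> w" if "w \<in> W" for w
  proof (cases "w = 0")
    case False
    have "H ((1 / norm w) *\<^sub>R w) \<bullet> ((1 / norm w) *\<^sub>R w) \<le> c"
      unfolding c_def using False that W_sub by (intro max) (auto simp: subspace_scale)
    then have "(H w \<bullet> w) / (norm w)\<^sup>2 \<le> c"
      using H by (simp add: linear_cmul power2_eq_square)
    then show ?thesis
      using False by (simp add: divide_le_eq power2_norm_eq_inner)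
  qed (use H in \<open>simp add: linear_0\<close>)
  define u where "u = c *\<^sub>R x - H x"
  have u: "u \<in> W" unfolding u_def using x W_sub W_inv by (simp add: subspace_diff subspace_scale)
  \<comment> \<open>The quadratic form \<open>c * (w \<bullet> w) - H w \<bullet> w\<close> is minimal at \<open>x\<close>, so its derivative
    vanishes there; \<open>u\<close> is the direction of the gradient.\<close>
  define k where "k = c * (u \<bullet> u) - H u \<bullet> u"
  have "0 \<le> 2 * t * (u \<bullet> u) + t\<^sup>2 * k" for t
  proof -
    have "c * ((x + t *\<^sub>R u) \<bullet> (x + t *\<^sub>R u)) - H (x + t *\<^sub>R u) \<bullet> (x + t *\<^sub>R u)
        = (c * (x \<bullet> x) - H x \<bullet> x) + 2 * t * (u \<bullet> (c *\<^sub>R x - H x)) + t\<^sup>2 * k"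
    proof -
      have "H u \<bullet> x = H x \<bullet> u" using sym[of u x] by (simp add: inner_commute)
      moreover have "x \<bullet> u = u \<bullet> x" "H x \<bullet> u = u \<bullet> H x" by (rule inner_commute)+
      ultimately show ?thesis
        using H unfolding k_def
        by (simp add: linear_add linear_cmul inner_add_left inner_add_right inner_diff_right
            power2_eq_square algebra_simps)
    qed
    moreover have "c * (x \<bullet> x) - H x \<bullet> x = 0"
      using x by (simp add: c_def norm_eq_1)
    ultimately show ?thesis
      using nonneg[of "x + t *\<^sub>R u"] x u W_sub
      by (simp add: subspace_add subspace_scale flip: u_def)
  qed
  \<comment> \<open>A negative multiple of the gradient, small enough for the linear term to dominate.\<close>
  from this[of "- (u \<bullet> u) / (\<bar>k\<bar> + 1)"]
  have "0 \<le> - 2 * ((u \<bullet> u)\<^sup>2 / (\<bar>k\<bar> + 1)) + (u \<bullet> u)\<^sup>2 / (\<bar>k\<bar> + 1) * (k / (\<bar>k\<bar> + 1))"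
    by (simp add: power2_eq_square)
  also have "\<dots> \<le> - 2 * ((u \<bullet> u)\<^sup>2 / (\<bar>k\<bar> + 1)) + (u \<bullet> u)\<^sup>2 / (\<bar>k\<bar> + 1) * 1"
    by (intro add_left_mono mult_left_mono) auto
  finally have "(u \<bullet> u)\<^sup>2 / (\<bar>k\<bar> + 1) \<le> 0" by simp
  moreover have "\<bar>k\<bar> + 1 > 0" by simp
  ultimately have "(u \<bullet> u)\<^sup>2 \<le> 0" by (metis divide_le_0_iff not_less)
  then have "u = 0" by simp
  then have "H x = c *\<^sub>R x" by (simp add: u_def)
  then have "x \<in> ?E" by blast
  with x have "x \<bullet> x = 0" by (auto simp: W_def)
  with x show False by simp
qed

lemma funpow_eigenvector:
  assumes "linear H" "H v = c *\<^sub>R v"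
  shows "(H ^^ j) v = c ^ j *\<^sub>R v"
  by (induction j) (simp_all add: assms linear_cmul mult.commute)

text \<open>
  The monic polynomial with the eigenvalues as simple roots annihilates every eigenvector, hence every
  vector. A self-adjoint operator with few eigenvalues thus has linearly dependent Krylov
  vectors \<open>v\<close>, \<open>H v\<close>, \<open>H (H v)\<close>, and so on.
\<close>

lemma selfadjoint_krylov_dependent:
  fixes H :: "'b::euclidean_space \<Rightarrow> 'b"
  assumes H: "linear H" and sym: "\<And>x y. H x \<bullet> y = x \<bullet> H y"
  defines "\<Lambda> \<equiv> {c. \<exists>v. v \<noteq> 0 \<and> H v = c *\<^sub>R v}"
  obtains a where "a (card \<Lambda>) = 1" "(\<Sum>j\<le>card \<Lambda>. a j *\<^sub>R (H ^^ j) v) = 0"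
proof -
  have fin: "finite \<Lambda>" unfolding \<Lambda>_def by (rule finite_eigenvalues[OF H])
  define q where "q = (\<Prod>c\<in>\<Lambda>. [:- c, 1:])"
  have deg: "degree q = card \<Lambda>"
    unfolding q_def by (subst degree_prod_sum_eq) auto
  have lead: "lead_coeff q = 1" by (simp add: q_def lead_coeff_prod)
  have pow: "linear (H ^^ j)" for j
  proof (induction j)
    case 0
    show ?case by (simp only: funpow.simps linear_id)
  next
    case (Suc j)
    show ?case using linear_compose[OF Suc H] by (simp only: funpow.simps)
  qed
  have "(\<Sum>j\<le>card \<Lambda>. coeff q j *\<^sub>R (H ^^ j) v) = 0"
  proof (rule linear_eq_0_on_span[where x = v and f = "\<lambda>v. \<Sum>j\<le>card \<Lambda>. coeff q j *\<^sub>R (H ^^ j) v" and b = "{v. \<exists>c. H v = c *\<^sub>R v}"])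
    show "linear (\<lambda>v. \<Sum>j\<le>card \<Lambda>. coeff q j *\<^sub>R (H ^^ j) v)"
      by (intro linear_compose_sum ballI linear_compose_scale_right pow)
    show "v \<in> span {v. \<exists>c. H v = c *\<^sub>R v}"
      using selfadjoint_eigenvectors_span[OF H sym] by simp
    fix u assume "u \<in> {v. \<exists>c. H v = c *\<^sub>R v}"
    then obtain c where c: "H u = c *\<^sub>R u" by blast
    have "(\<Sum>j\<le>card \<Lambda>. coeff q j *\<^sub>R (H ^^ j) u) = poly q c *\<^sub>R u"
      by (simp add: funpow_eigenvector[OF H c] poly_altdef deg flip: scaleR_sum_left)
    also have "\<dots> = 0"
    proof (cases "u = 0")
      case False
      then have "c \<in> \<Lambda>" using c by (auto simp: \<Lambda>_def)
      then show ?thesis using fin by (auto simp: q_def poly_prod)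
    qed simp
    finally show "(\<Sum>j\<le>card \<Lambda>. coeff q j *\<^sub>R (H ^^ j) u) = 0" .
  qed
  moreover have "coeff q (card \<Lambda>) = 1" using lead deg by simp
  ultimately show ?thesis by (rule that[rotated])
qed

lemma polynomial_function_bilinear:
  fixes h :: "'b::euclidean_space \<Rightarrow> 'c::euclidean_space \<Rightarrow> 'd::euclidean_space"
  assumes h: "bilinear h" and f: "polynomial_function f" and g: "polynomial_function g"
  shows "polynomial_function (\<lambda>x. h (f x) (g x))"
proof -
  have "h (f x) (g x) = (\<Sum>i\<in>Basis. \<Sum>j\<in>Basis. (f x \<bullet> i) *\<^sub>R ((g x \<bullet> j) *\<^sub>R h i j))" for x
  proof -
    have "h (f x) (g x) = h (\<Sum>i\<in>Basis. (f x \<bullet> i) *\<^sub>R i) (\<Sum>j\<in>Basis. (g x \<bullet> j) *\<^sub>R j)"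
      by (simp add: euclidean_representation)
    also have "\<dots> = (\<Sum>i\<in>Basis. \<Sum>j\<in>Basis. (f x \<bullet> i) *\<^sub>R ((g x \<bullet> j) *\<^sub>R h i j))"
      using h by (simp add: bilinear_sum bilinear_lmul bilinear_rmul sum.cartesian_product)
    finally show ?thesis .
  qed
  moreover have "polynomial_function (\<lambda>x. f x \<bullet> i)" "polynomial_function (\<lambda>x. g x \<bullet> j)"
    for i j
    using polynomial_function_compose[OF f polynomial_function_bounded_linear[OF bounded_linear_inner_left[of i]]]
      polynomial_function_compose[OF g polynomial_function_bounded_linear[OF bounded_linear_inner_left[of j]]]
    by (simp_all add: o_def)
  ultimately show ?thesis
    by (simp only:) (intro polynomial_function_sum polynomial_function_mult finite_Basis polynomial_function_const)
qed

section \<open>Matrices of full rank with distinct singular values\<close>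

lemma real_polynomial_function_finite_zeros:
  fixes f :: "real \<Rightarrow> real"
  assumes f: "real_polynomial_function f" and nz: "f a \<noteq> 0"
  shows "finite {x. f x = 0}"
proof -
  obtain c n where c: "f = (\<lambda>x. \<Sum>i\<le>n. c i * x ^ i)"
    using f unfolding real_polynomial_function_iff_sum by blast
  with nz have "(\<Sum>i\<le>n. c i * a ^ i) \<noteq> 0" by simp
  then obtain i where "i \<in> {..n}" "c i * a ^ i \<noteq> 0" using sum.not_neutral_contains_not_neutral by blast
  then have "\<exists>i\<le>n. c i \<noteq> 0" by auto
  then show ?thesis unfolding c using polyfun_finite_roots[of c n] by simp
qed

lemma linear_mvec: "linear (mvec A)"
  using bilinear_mvec unfolding bilinear_def by blast

lemma continuous_on_mvec [continuous_intros]: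
  "continuous_on S f \<Longrightarrow> continuous_on S g \<Longrightarrow> continuous_on S (\<lambda>x. mvec (f x) (g x))"
  using bilinear_conv_bounded_bilinear[of mvec] bilinear_mvec bounded_bilinear.continuous_on by blast

lemma continuous_on_mstar [continuous_intros]:
  "continuous_on S f \<Longrightarrow> continuous_on S (\<lambda>x. mstar (f x))"
  using linear_mstar linear_conv_bounded_linear bounded_linear.continuous_on by blast

lemma gram_operator_selfadjoint:
  "mvec (mstar Z) (mvec Z x) \<bullet> y = x \<bullet> mvec (mstar Z) (mvec Z y)"
  by (metis inner_mstar inner_commute)

lemma linear_gram_operator: "linear (\<lambda>v. mvec (mstar Z) (mvec Z v))"
  using linear_compose[OF linear_mvec[of Z] linear_mvec[of "mstar Z"]] by (simp add: o_def)

text \<open>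
  The eigenvalues of \<open>v \<mapsto> Z* (Z v)\<close> are the squares of the singular values, and injectivity of \<open>Z\<close>
  makes them positive.
\<close>

lemma full_rank_distinct_if_many_eigenvalues:
  fixes Z :: "'a::normed_division_algebra ^ 'm ^ 'n"
  assumes inj: "\<And>v. mvec Z v = 0 \<Longrightarrow> v = 0"
    and many: "CARD('m) \<le> card {c. \<exists>v. v \<noteq> 0 \<and> mvec (mstar Z) (mvec Z v) = c *\<^sub>R v}"
  shows "Z \<in> full_rank_distinct"
proof -
  let ?\<Lambda> = "{c. \<exists>v. v \<noteq> 0 \<and> mvec (mstar Z) (mvec Z v) = c *\<^sub>R v}"
  have pos: "c > 0" if "c \<in> ?\<Lambda>" for c
  proof -
    from that have "\<exists>v. v \<noteq> 0 \<and> mvec (mstar Z) (mvec Z v) = c *\<^sub>R v" by simp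
    then obtain v where v: "v \<noteq> 0" "mvec (mstar Z) (mvec Z v) = c *\<^sub>R v" by blast
    have "mvec Z v \<bullet> mvec Z v = c * (v \<bullet> v)"
      using inner_mstar[of Z "mvec Z v" v] v by simp
    moreover have "mvec Z v \<bullet> mvec Z v > 0" "v \<bullet> v > 0" using inj v by auto
    ultimately show ?thesis using zero_less_mult_pos2[of c "v \<bullet> v"] by simp
  qed
  have "finite ?\<Lambda>" by (rule finite_eigenvalues[OF linear_gram_operator])
  then have "\<exists>e :: 'm \<Rightarrow> real. inj e \<and> range e \<subseteq> ?\<Lambda>"
    using inj_on_iff_card_le[of "UNIV :: 'm set" ?\<Lambda>] many by (simp only: finite)
  then obtain e :: "'m \<Rightarrow> real" where e: "inj e" "range e \<subseteq> ?\<Lambda>"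
    by (elim exE conjE)
  have "inj (\<lambda>i. sqrt (e i))"
    using e(1) by (auto simp: inj_def)
  moreover have "0 < sqrt (e i) \<and> singular_value Z (sqrt (e i))" for i
  proof -
    have "e i \<in> ?\<Lambda>" using e(2) by blast
    with pos[of "e i"] show ?thesis by (simp add: singular_value_def less_imp_le)
  qed
  ultimately show ?thesis
    unfolding full_rank_distinct_def using inj by blast
qed

lemma full_rank_distinct_scaleR:
  fixes Z :: "'a::normed_division_algebra ^ 'm ^ 'n"
  assumes Z: "Z \<in> full_rank_distinct" and c: "c \<noteq> 0"
  shows "c *\<^sub>R Z \<in> full_rank_distinct"
proof -
  obtain s :: "'m \<Rightarrow> real" where s: "inj s" "\<And>i. 0 < s i" "\<And>i. singular_value Z (s i)"
    using Z unfolding full_rank_distinct_def by blast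
  have mv: "mvec (c *\<^sub>R Z) v = c *\<^sub>R mvec Z v" for v
    by (rule bilinear_lmul[OF bilinear_mvec])
  have mvs: "mvec (mstar (c *\<^sub>R Z)) v = c *\<^sub>R mvec (mstar Z) v" for v
    by (simp add: linear_cmul[OF linear_mstar] bilinear_lmul[OF bilinear_mvec])
  have "singular_value (c *\<^sub>R Z) (\<bar>c\<bar> * s i)" for i
    using s(3)[of i] unfolding singular_value_def mv mvs
    by (auto simp: linear_cmul[OF linear_mvec] power_mult_distrib power2_eq_square)
  moreover have "inj (\<lambda>i. \<bar>c\<bar> * s i)" using s(1) c by (auto simp: inj_def)
  moreover have "0 < \<bar>c\<bar> * s i" for i using s(2) c by simp
  moreover have "mvec (c *\<^sub>R Z) v = 0 \<longrightarrow> v = 0" for v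
    using Z c unfolding full_rank_distinct_def mv by auto
  ultimately show ?thesis
    unfolding full_rank_distinct_def by (auto intro!: exI[of _ "\<lambda>i. \<bar>c\<bar> * s i"])
qed

text \<open>
  Failure of injectivity is witnessed by a unit vector, and distinct positive singular values by the
  values themselves with unit eigenvectors. For \<open>R k\<close> the strict inequalities are sharpened to gaps of
  at least \<open>1 / Suc k\<close>, which makes the relation closed.
\<close>

lemma full_rank_distinct_borel:
  "(full_rank_distinct :: ('a::normed_division_algebra ^ 'm ^ 'n) set) \<in> sets borel"
proof -
  let ?N = "{(Z :: 'a ^ 'm ^ 'n, v). norm v = 1 \<and> mvec Z v = 0}"
  define R where "R = (\<lambda>k::nat. {(Z :: 'a ^ 'm ^ 'n, s :: real ^ 'm, V :: ('a ^ 'm) ^ 'm).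
      (\<forall>i. 1 / Suc k \<le> s $ i \<and> norm (V $ i) = 1 \<and>
        mvec (mstar Z) (mvec Z (V $ i)) = (s $ i)\<^sup>2 *\<^sub>R V $ i) \<and>
      (\<forall>i j. i \<noteq> j \<longrightarrow> 1 / Suc k \<le> \<bar>s $ i - s $ j\<bar>)})"
  have inj: "(\<forall>v. mvec Z v = 0 \<longrightarrow> v = 0) \<longleftrightarrow> Z \<notin> fst ` ?N" for Z :: "'a ^ 'm ^ 'n"
  proof
    assume *: "Z \<notin> fst ` ?N"
    show "\<forall>v. mvec Z v = 0 \<longrightarrow> v = 0"
    proof (intro allI impI, rule ccontr)
      fix v assume v: "mvec Z v = 0" "v \<noteq> 0"
      then have "(Z, (1 / norm v) *\<^sub>R v) \<in> ?N" by (simp add: linear_cmul[OF linear_mvec])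
      with * show False by force
    qed
  qed auto
  have dist: "(\<exists>s :: 'm \<Rightarrow> real. inj s \<and> (\<forall>i. 0 < s i \<and> singular_value Z (s i))) \<longleftrightarrow>
      Z \<in> (\<Union>k. fst ` R k)" for Z :: "'a ^ 'm ^ 'n"
  proof
    assume "\<exists>s :: 'm \<Rightarrow> real. inj s \<and> (\<forall>i. 0 < s i \<and> singular_value Z (s i))"
    then obtain s :: "'m \<Rightarrow> real" and v where s: "inj s" "\<And>i. 0 < s i"
      and v: "\<And>i. v i \<noteq> 0" "\<And>i. mvec (mstar Z) (mvec Z (v i)) = (s i)\<^sup>2 *\<^sub>R v i"
      unfolding singular_value_def by metis
    define d where "d = Min (range s \<union> (\<lambda>(i, j). \<bar>s i - s j\<bar>) ` {(i, j). i \<noteq> j})"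
    have d: "d \<le> s i" "i \<noteq> j \<Longrightarrow> d \<le> \<bar>s i - s j\<bar>" for i j
      unfolding d_def by (rule Min_le; force)+
    have "d > 0"
      unfolding d_def using s by (subst Min_gr_iff) (auto simp: inj_eq)
    then obtain k where k: "1 / Suc k < d"
      using nat_approx_posE[of d] by blast
    have "1 / real (Suc k) \<le> s i" "i \<noteq> j \<Longrightarrow> 1 / real (Suc k) \<le> \<bar>s i - s j\<bar>" for i j
      using k d(1)[of i] d(2)[of i j] by linarith+
    then have "(Z, \<chi> i. s i, \<chi> i. (1 / norm (v i)) *\<^sub>R v i) \<in> R k"
      using v unfolding R_def by (simp add: linear_cmul[OF linear_mvec])
    then show "Z \<in> (\<Union>k. fst ` R k)" by force
  next
    assume "Z \<in> (\<Union>k. fst ` R k)"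
    then obtain k s V where R: "(Z, s, V) \<in> R k" by auto
    have pos: "0 < 1 / real (Suc k)" by simp
    have "inj (\<lambda>i. s $ i)"
    proof (rule injI, rule ccontr)
      fix i j assume "s $ i = s $ j" "i \<noteq> j"
      then have "1 / real (Suc k) \<le> \<bar>s $ i - s $ j\<bar>" using R unfolding R_def by blast
      with pos \<open>s $ i = s $ j\<close> show False by simp
    qed
    moreover have "0 < s $ i \<and> singular_value Z (s $ i)" for i
    proof -
      have "1 / real (Suc k) \<le> s $ i" "norm (V $ i) = 1"
        and eig: "mvec (mstar Z) (mvec Z (V $ i)) = (s $ i)\<^sup>2 *\<^sub>R V $ i"
        using R unfolding R_def by auto
      then have "0 < s $ i" "V $ i \<noteq> 0" using pos by (linarith, auto)
      then show ?thesis using eig unfolding singular_value_def by (auto intro!: exI[of _ "V $ i"])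
    qed
    ultimately show "\<exists>s :: 'm \<Rightarrow> real. inj s \<and> (\<forall>i. 0 < s i \<and> singular_value Z (s i))"
      by (intro exI[of _ "\<lambda>i. s $ i"]) simp
  qed
  have "closed ?N"
    unfolding case_prod_beta' by (intro closed_Collect_conj closed_Collect_eq continuous_intros)
  moreover have "closed (R k)" for k
    unfolding R_def case_prod_beta'
    by (intro closed_Collect_conj closed_Collect_all closed_Collect_imp open_Collect_const
        closed_Collect_eq closed_Collect_le continuous_intros)
  ultimately have "- fst ` ?N \<inter> (\<Union>k. fst ` R k) \<in> sets borel"
    by (intro sets.Int borel_comp sets.countable_UN image_subsetI projection_of_closed_borel)
  moreover have "full_rank_distinct = - fst ` ?N \<inter> (\<Union>k. fst ` R k)"
    unfolding full_rank_distinct_def by (rule set_eqI) (simp only: inj dist mem_Collect_eq Int_iff Compl_iff)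
  ultimately show ?thesis by (simp only:)
qed

lemma det_nonzero_iff_ker:
  fixes A :: "real ^ 'n ^ 'n"
  shows "det A \<noteq> 0 \<longleftrightarrow> (\<forall>x. A *v x = 0 \<longrightarrow> x = 0)"
  by (simp add: invertible_det_nz[symmetric] invertible_left_inverse matrix_left_invertible_ker)

text \<open>
  The columns are the real parts of the Krylov vectors of the all-ones vector, where \<open>r\<close> enumerates the
  exponents. Passing to real parts yields a square real matrix over every algebra, so that an
  ordinary determinant can detect linear independence.
\<close>

definition krylov_matrix ::
    "('m \<Rightarrow> nat) \<Rightarrow> ('a::normed_division_algebra ^ 'm \<Rightarrow> 'a ^ 'm) \<Rightarrow> real ^ 'm ^ 'm" where
  "krylov_matrix r H = (\<chi> i j. nda_Re ((H ^^ r j) (\<chi> i. 1) $ i))"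

lemma many_eigenvalues_if_krylov_det_nonzero:
  fixes H :: "'a::normed_division_algebra ^ 'm \<Rightarrow> 'a ^ 'm"
  assumes H: "linear H" and sym: "\<And>x y. H x \<bullet> y = x \<bullet> H y"
    and r: "bij_betw r (UNIV :: 'm set) {..<CARD('m)}"
    and det: "det (krylov_matrix r H) \<noteq> 0"
  shows "CARD('m) \<le> card {c. \<exists>v. v \<noteq> 0 \<and> H v = c *\<^sub>R v}" (is "_ \<le> card ?\<Lambda>")
proof (rule ccontr)
  assume "\<not> CARD('m) \<le> card ?\<Lambda>"
  then have lt: "card ?\<Lambda> < CARD('m)" by simp
  let ?v = "\<chi> i. 1 :: 'a ^ 'm"
  obtain a where a: "a (card ?\<Lambda>) = 1" "(\<Sum>k\<le>card ?\<Lambda>. a k *\<^sub>R (H ^^ k) ?v) = 0"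
    using selfadjoint_krylov_dependent[OF H sym] by blast
  define b where "b k = (if k \<le> card ?\<Lambda> then a k else 0)" for k
  have sum0: "(\<Sum>k<CARD('m). b k *\<^sub>R (H ^^ k) ?v) = 0"
  proof -
    have "(\<Sum>k<CARD('m). b k *\<^sub>R (H ^^ k) ?v) = (\<Sum>k\<le>card ?\<Lambda>. a k *\<^sub>R (H ^^ k) ?v)"
      using lt by (intro sum.mono_neutral_cong_right) (auto simp: b_def)
    then show ?thesis using a by simp
  qed
  have "krylov_matrix r H *v (\<chi> j. b (r j)) = 0"
  proof -
    have "(\<Sum>j\<in>UNIV. nda_Re ((H ^^ r j) ?v $ i) * b (r j)) = 0" for i
    proof -
      have "(\<Sum>j\<in>UNIV. nda_Re ((H ^^ r j) ?v $ i) * b (r j))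
          = (\<Sum>k<CARD('m). nda_Re ((H ^^ k) ?v $ i) * b k)"
        by (rule sum.reindex_bij_betw[OF r])
      also have "\<dots> = nda_Re ((\<Sum>k<CARD('m). b k *\<^sub>R (H ^^ k) ?v) $ i)"
        by (simp add: nda_Re_linear mult.commute)
      finally show ?thesis by (simp add: sum0 nda_Re_def)
    qed
    then show ?thesis by (simp add: krylov_matrix_def matrix_vector_mult_def vec_eq_iff)
  qed
  then have z: "b (r j) = 0" for j
    using det unfolding det_nonzero_iff_ker by (auto simp: vec_eq_iff)
  obtain j where "r j = card ?\<Lambda>"
    using r lt unfolding bij_betw_def by (metis (no_types, lifting) imageE lessThan_iff)
  then show False using z[of j] a(1) by (simp add: b_def)
qed

text \<open>
  For a diagonal operator this is a Vandermonde determinant: a vector in the kernel is the coefficient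
  vector of a polynomial of degree less than \<open>CARD('m)\<close> with \<open>CARD('m)\<close> distinct roots.
\<close>

lemma krylov_det_diagonal_nonzero:
  fixes H :: "'a::normed_division_algebra ^ 'm \<Rightarrow> 'a ^ 'm"
  assumes H: "\<And>v i. H v $ i = d i *\<^sub>R v $ i" and d: "inj d"
    and r: "bij_betw r (UNIV :: 'm set) {..<CARD('m)}"
  shows "det (krylov_matrix r H) \<noteq> 0"
  unfolding det_nonzero_iff_ker
proof (intro allI impI)
  fix c assume c: "krylov_matrix r H *v c = 0"
  have pow: "(H ^^ k) v $ i = d i ^ k *\<^sub>R v $ i" for k v i
    by (induction k) (simp_all add: H)
  have eq: "(\<Sum>j\<in>UNIV. d i ^ r j * c $ j) = 0" for i
    using arg_cong[OF c, of "\<lambda>x. x $ i"]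
    by (simp add: krylov_matrix_def matrix_vector_mult_def pow)
  define b where "b k = c $ inv_into UNIV r k" for k
  have br: "b (r j) = c $ j" for j
    using r by (simp add: b_def bij_betw_def)
  have root: "(\<Sum>k\<le>CARD('m) - 1. b k * d i ^ k) = 0" for i
  proof -
    have "{..CARD('m) - 1} = {..<CARD('m)}"
      using zero_less_card_finite[where 'a = 'm] by (metis Suc_pred' lessThan_Suc_atMost)
    then have "(\<Sum>k\<le>CARD('m) - 1. b k * d i ^ k) = (\<Sum>j\<in>UNIV. b (r j) * d i ^ r j)"
      using sum.reindex_bij_betw[OF r, of "\<lambda>k. b k * d i ^ k"] by simp
    also have "\<dots> = 0" using eq[of i] by (simp add: br mult.commute)
    finally show ?thesis .
  qed
  have "c $ j = 0" for j
  proof (rule ccontr)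
    assume "c $ j \<noteq> 0"
    moreover have "r j \<le> CARD('m) - 1"
    proof -
      have "r j < CARD('m)" using r unfolding bij_betw_def by blast
      then show ?thesis by linarith
    qed
    ultimately have "\<exists>k\<le>CARD('m) - 1. b k \<noteq> 0" using br[of j] by metis
    then have fin: "finite {z. (\<Sum>k\<le>CARD('m) - 1. b k * z ^ k) = 0}"
      and le: "card {z. (\<Sum>k\<le>CARD('m) - 1. b k * z ^ k) = 0} \<le> CARD('m) - 1"
      using polyfun_rootbound[of "CARD('m) - 1" b] by blast+
    have "range d \<subseteq> {z. (\<Sum>k\<le>CARD('m) - 1. b k * z ^ k) = 0}" using root by auto
    then have "card (range d) \<le> CARD('m) - 1" using card_mono[OF fin] le by (meson order_trans)
    moreover have "CARD('m) > 0" by simp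
    ultimately show False using card_image[OF d] by linarith
  qed
  then show "c = 0" by (simp add: vec_eq_iff)
qed

text \<open>
  The base point \<open>Z0\<close> is rectangular diagonal with entries \<open>1, 2, \<dots>\<close>. If \<open>Z0 + s W\<close> is not
  injective, then \<open>-1/s\<close> is an eigenvalue of the operator \<open>K\<close> obtained by restricting \<open>W\<close> to the rows
  that \<open>Z0\<close> occupies and dividing by the diagonal. If it is injective but does not have
  enough singular values, then \<open>s\<close> is a zero of the Krylov determinant, a polynomial in \<open>s\<close> that does
  not vanish at 0.
\<close>

lemma finite_exceptional_parameters:
  fixes Z0 W :: "'a::normed_division_algebra ^ 'm ^ 'n"
  assumes \<iota>: "inj (\<iota> :: 'm \<Rightarrow> 'n)" and r: "bij_betw r (UNIV :: 'm set) {..<CARD('m)}"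
    and Z0: "Z0 = (\<chi> k j. if k = \<iota> j then (real (r j) + 1) *\<^sub>R 1 else 0)"
  shows "finite {s. Z0 + s *\<^sub>R W \<notin> full_rank_distinct}"
proof -
  define H where "H s v = mvec (mstar (Z0 + s *\<^sub>R W)) (mvec (Z0 + s *\<^sub>R W) v)" for s v
  have mvec_Z0: "mvec Z0 v $ \<iota> j = (real (r j) + 1) *\<^sub>R v $ j" for v j
  proof -
    have "mvec Z0 v $ \<iota> j = (\<Sum>i\<in>UNIV. if i = j then (real (r j) + 1) *\<^sub>R v $ j else 0)"
      unfolding mvec_def Z0 vec_lambda_beta using \<iota>
      by (intro sum.cong refl) (auto simp: inj_eq nda_scaleR_left nda_one_left)
    then show ?thesis by simp
  qed
  have mvec_star: "mvec (mstar Z0) w $ j = (real (r j) + 1) *\<^sub>R w $ \<iota> j" for w j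
  proof -
    have "mvec (mstar Z0) w $ j = (\<Sum>k\<in>UNIV. if k = \<iota> j then (real (r j) + 1) *\<^sub>R w $ \<iota> j else 0)"
      unfolding mvec_def mstar_def Z0 vec_lambda_beta
      by (intro sum.cong refl) (auto simp: nda_scaleR_left nda_one_left)
    then show ?thesis by simp
  qed
  have poly: "polynomial_function (\<lambda>s. (H s ^^ k) v)" for k v
  proof (induction k)
    case (Suc k)
    have A: "polynomial_function (\<lambda>s. Z0 + s *\<^sub>R W)"
      by (intro polynomial_function_add polynomial_function_mult polynomial_function_const polynomial_function_id)
    then have "polynomial_function (\<lambda>s. mstar (Z0 + s *\<^sub>R W))"
      using polynomial_function_compose[OF A polynomial_function_bounded_linear[of mstar]] linear_mstar
      by (simp add: o_def linear_conv_bounded_linear)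
    then show ?case
      unfolding funpow.simps o_def H_def
      using A Suc[unfolded H_def] by (intro polynomial_function_bilinear[OF bilinear_mvec])
  qed simp
  have "real_polynomial_function (\<lambda>s. det (krylov_matrix r (H s)))"
    unfolding det_def krylov_matrix_def
  proof (intro real_polynomial_function_sum real_polynomial_function.intros(4) real_polynomial_function.intros(2)
      real_polynomial_function_prod finite)
    fix p i
    have "bounded_linear (\<lambda>x :: 'a ^ 'm. nda_Re (x $ i))"
      using bounded_linear_compose[OF bounded_linear_nda_Re bounded_linear_vec_nth] .
    then show "real_polynomial_function (\<lambda>s. (\<chi> i j. nda_Re ((H s ^^ r j) (\<chi> i. 1) $ i)) $ i $ p i)"
      using polynomial_function_compose[OF poly polynomial_function_bounded_linear]
      by (simp add: o_def real_polynomial_function_eq)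
  qed
  moreover have "det (krylov_matrix r (H 0)) \<noteq> 0"
  proof (rule krylov_det_diagonal_nonzero[OF _ _ r])
    show "H 0 v $ i = (real (r i) + 1)\<^sup>2 *\<^sub>R v $ i" for v i
      by (simp add: H_def mvec_Z0 mvec_star power2_eq_square)
    show "inj (\<lambda>i. (real (r i) + 1)\<^sup>2)"
      using r by (auto simp: inj_def power2_eq_iff_nonneg bij_betw_def)
  qed
  ultimately have fin1: "finite {s. det (krylov_matrix r (H s)) = 0}"
    by (rule real_polynomial_function_finite_zeros)
  define K where "K v = (\<chi> j. (1 / (real (r j) + 1)) *\<^sub>R mvec W v $ \<iota> j)" for v
  have K: "linear K"
    unfolding K_def
    by (auto intro!: linearI simp: vec_eq_iff linear_add[OF linear_mvec] linear_cmul[OF linear_mvec]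
        scaleR_add_right)
  have fin2: "finite {s. \<exists>v. v \<noteq> 0 \<and> mvec (Z0 + s *\<^sub>R W) v = 0}"
  proof (rule finite_subset)
    show "finite ((\<lambda>c. - 1 / c) ` {c. \<exists>v. v \<noteq> 0 \<and> K v = c *\<^sub>R v})"
      by (intro finite_imageI finite_eigenvalues K)
    show "{s. \<exists>v. v \<noteq> 0 \<and> mvec (Z0 + s *\<^sub>R W) v = 0}
        \<subseteq> (\<lambda>c. - 1 / c) ` {c. \<exists>v. v \<noteq> 0 \<and> K v = c *\<^sub>R v}"
    proof
      fix s assume "s \<in> {s. \<exists>v. v \<noteq> 0 \<and> mvec (Z0 + s *\<^sub>R W) v = 0}"
      then obtain v where v: "v \<noteq> 0" "mvec (Z0 + s *\<^sub>R W) v = 0" by auto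
      have sum0: "mvec Z0 v + s *\<^sub>R mvec W v = 0"
        using v(2) by (simp add: bilinear_ladd[OF bilinear_mvec] bilinear_lmul[OF bilinear_mvec])
      have "v $ j + s *\<^sub>R K v $ j = 0" for j
      proof -
        have "(real (r j) + 1) *\<^sub>R v $ j + s *\<^sub>R mvec W v $ \<iota> j = 0"
          using arg_cong[OF sum0, of "\<lambda>x. x $ \<iota> j"] by (simp add: mvec_Z0)
        then have "(1 / (real (r j) + 1)) *\<^sub>R ((real (r j) + 1) *\<^sub>R v $ j + s *\<^sub>R mvec W v $ \<iota> j) = 0"
          by simp
        moreover have "real (r j) + 1 \<noteq> 0" by linarith
        ultimately show ?thesis by (simp add: K_def scaleR_add_right mult.commute)
      qed
      then have "v + s *\<^sub>R K v = 0" by (simp add: vec_eq_iff)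
      then have eq: "s *\<^sub>R K v = - v" by (simp add: eq_neg_iff_add_eq_0 add.commute)
      have s: "s \<noteq> 0" using eq v(1) by auto
      have "K v = (1 / s) *\<^sub>R (s *\<^sub>R K v)" using s by simp
      also have "\<dots> = (- 1 / s) *\<^sub>R v" by (simp add: eq)
      finally have "- 1 / s \<in> {c. \<exists>v. v \<noteq> 0 \<and> K v = c *\<^sub>R v}" using v(1) by blast
      moreover have "s = - 1 / (- 1 / s)" using s by simp
      ultimately show "s \<in> (\<lambda>c. - 1 / c) ` {c. \<exists>v. v \<noteq> 0 \<and> K v = c *\<^sub>R v}" by blast
    qed
  qed
  have "{s. Z0 + s *\<^sub>R W \<notin> full_rank_distinct} \<subseteq>
      {s. det (krylov_matrix r (H s)) = 0} \<union> {s. \<exists>v. v \<noteq> 0 \<and> mvec (Z0 + s *\<^sub>R W) v = 0}"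
  proof (rule subsetI, rule ccontr)
    fix s
    assume s: "s \<in> {s. Z0 + s *\<^sub>R W \<notin> full_rank_distinct}"
      "s \<notin> {s. det (krylov_matrix r (H s)) = 0} \<union> {s. \<exists>v. v \<noteq> 0 \<and> mvec (Z0 + s *\<^sub>R W) v = 0}"
    have "CARD('m) \<le> card {c. \<exists>v. v \<noteq> 0 \<and> H s v = c *\<^sub>R v}"
      using s(2) linear_gram_operator gram_operator_selfadjoint unfolding H_def[abs_def]
      by (intro many_eigenvalues_if_krylov_det_nonzero[OF _ _ r]) auto
    then have "Z0 + s *\<^sub>R W \<in> full_rank_distinct"
      using s(2) unfolding H_def by (intro full_rank_distinct_if_many_eigenvalues) auto
    then show False using s(1) by simp
  qed
  then show ?thesis using fin1 fin2 finite_subset by blast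
qed

lemma full_rank_distinct_conull:
  assumes "CARD('m) \<le> CARD('n)"
  shows "- (full_rank_distinct :: ('a::normed_division_algebra ^ 'm ^ 'n) set) \<in> null_sets lborel"
proof -
  obtain \<iota> :: "'m \<Rightarrow> 'n" where \<iota>: "inj \<iota>"
    using assms inj_on_iff_card_le[of "UNIV :: 'm set" "UNIV :: 'n set"] by auto
  obtain r :: "'m \<Rightarrow> nat" where r: "bij_betw r UNIV {..<CARD('m)}"
    using ex_bij_betw_finite_nat[of "UNIV :: 'm set"] by (auto simp: atLeast0LessThan)
  show ?thesis
  proof (rule null_set_if_finite_line_sections)
    show "- full_rank_distinct \<in> sets (borel :: ('a ^ 'm ^ 'n) measure)"
      using full_rank_distinct_borel by (rule borel_comp)
    show "c *\<^sub>R Z \<in> - full_rank_distinct"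
      if "Z \<in> - full_rank_distinct" "c \<noteq> 0" for Z :: "'a ^ 'm ^ 'n" and c
      using full_rank_distinct_scaleR[of "c *\<^sub>R Z" "1 / c"] that by auto
    show "finite {s. (\<chi> k j. if k = \<iota> j then (real (r j) + 1) *\<^sub>R 1 else 0) + s *\<^sub>R W
        \<in> - (full_rank_distinct :: ('a ^ 'm ^ 'n) set)}" for W
      using finite_exceptional_parameters[OF \<iota> r refl] by simp
  qed
qed

section \<open>Triangular multiplication and the Cholesky decomposition\<close>

lemma nda_one_neq_zero [simp]: "(1::'a::normed_division_algebra) \<noteq> 0"
  using nda_norm_one[where 'a = 'a] by auto

text \<open>
  The value of a two-sided multiplication on a matrix with one nonzero entry, from which its matrix in
  the standard basis can be read off.
\<close>

lemma mmul_mmul_axis: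
  "(A \<star> axis i (axis j e) \<star> B) $ k $ l = (A $ k $ i * e) * B $ j $ l"
proof -
  have inner: "(A \<star> axis i (axis j e)) $ k $ p = (if p = j then A $ k $ i * e else 0)" for p
  proof -
    have "(A \<star> axis i (axis j e)) $ k $ p = (\<Sum>q\<in>UNIV. if q = i then (if p = j then A $ k $ i * e else 0) else 0)"
      unfolding mmul_def vec_lambda_beta by (intro sum.cong refl) (auto simp: axis_def)
    then show ?thesis by simp
  qed
  have "(A \<star> axis i (axis j e) \<star> B) $ k $ l
      = (\<Sum>p\<in>UNIV. if p = j then (A $ k $ i * e) * B $ j $ l else 0)"
    by (subst mmul_def, unfold vec_lambda_beta) (intro sum.cong refl, simp add: inner)
  then show ?thesis by simp
qed

lemma Basis_matrix:
  "(Basis :: ('a::euclidean_space ^ 'm ^ 'n) set) = (\<lambda>(i, j, e). axis i (axis j e)) ` (UNIV \<times> UNIV \<times> Basis)"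
  unfolding Basis_vec_def by force

lemma inj_on_axis_axis:
  "inj_on (\<lambda>(i, j, e). axis i (axis j e)) (UNIV \<times> UNIV \<times> (Basis :: 'a::euclidean_space set))"
  by (auto simp: inj_on_def axis_eq_axis)

text \<open>
  The map sends the entry at \<open>(i, j)\<close> to entries at \<open>(k, l)\<close> with \<open>i \<le> k\<close> and \<open>j \<le> l\<close> only, so the sum
  of the positions of row and column is a rank for which it is triangular. On the diagonal it
  multiplies by the real number \<open>v i * u j\<close>, in each of the \<open>DIM('a)\<close> real coordinates of the entry.
\<close>

lemma triangular_multiplication:
  fixes V :: "'a::normed_division_algebra ^ 'n::{finite,wellorder} ^ 'n::{finite,wellorder}"
    and U :: "'a ^ 'm::{finite,wellorder} ^ 'm::{finite,wellorder}"
  assumes V: "upper_pos V" and U: "upper_pos U"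
  defines "T \<equiv> \<lambda>Z :: 'a ^ 'm::{finite,wellorder} ^ 'n::{finite,wellorder}. mstar V \<star> Z \<star> U"
  shows linear_triangular_multiplication: "linear T"
    and bij_triangular_multiplication: "bij T"
    and nn_integral_triangular_multiplication: "f \<in> borel_measurable borel \<Longrightarrow>
      (\<integral>\<^sup>+x. f x \<partial>lborel) =
        ennreal (mdet (mstar U \<star> U) powr (real CARD('n) * real DIM('a) / 2) *
          mdet (mstar V \<star> V) powr (real CARD('m) * real DIM('a) / 2)) * (\<integral>\<^sup>+x. f (T x) \<partial>lborel)"
proof -
  show T: "linear T"
    unfolding T_def
    by (auto intro!: linearI simp: bilinear_radd[OF bilinear_mmul] bilinear_ladd[OF bilinear_mmul]
        bilinear_rmul[OF bilinear_mmul] bilinear_lmul[OF bilinear_mmul])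
  obtain v where v: "\<And>i. v i > 0" "\<And>i. V $ i $ i = v i *\<^sub>R 1"
    using V unfolding upper_pos_def by metis
  obtain u where u: "\<And>i. u i > 0" "\<And>i. U $ i $ i = u i *\<^sub>R 1"
    using U unfolding upper_pos_def by metis
  have diag: "T (axis i (axis j e)) \<bullet> axis i (axis j e') = v i * u j * (e \<bullet> e')" for i j e e'
    by (simp add: T_def inner_axis mmul_mmul_axis mstar_def v(2) u(2) nda_scaleR_left
        nda_scaleR_right nda_one_left nda_one_right mult.assoc mult.left_commute)
  have off: "T (axis i (axis j e)) $ k $ l = 0" if "k < i \<or> l < j" for i j k l e
    using U V that by (auto simp: T_def mmul_mmul_axis mstar_def upper_pos_def)
  define w where "w i j = card {..<i} + card {..<j}" for i :: 'n and j :: 'm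
  \<comment> \<open>A basis matrix has one nonzero entry, so the sum reads off the rank of its position.\<close>
  define \<rho> where "\<rho> b = (\<Sum>i\<in>UNIV. \<Sum>j\<in>UNIV. if b $ i $ j = 0 then 0 else w i j)" for b :: "'a ^ 'm::{finite,wellorder} ^ 'n::{finite,wellorder}"
  have \<rho>: "\<rho> (axis i (axis j e)) = w i j" if "e \<in> Basis" for i j e
  proof -
    have "(\<Sum>q\<in>UNIV. if axis i (axis j e) $ p $ q = 0 then 0 else w p q) = (if p = i then w i j else 0)" for p
    proof -
      have "(\<Sum>q\<in>UNIV. if axis i (axis j e) $ p $ q = 0 then 0 else w p q)
          = (\<Sum>q\<in>UNIV. if q = j then (if p = i then w i j else 0) else 0)"
        using that by (intro sum.cong refl) (auto simp: axis_def)
      then show ?thesis by simp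
    qed
    then show ?thesis by (simp add: \<rho>_def)
  qed
  have tri: "T b \<bullet> b' = 0" if b: "b \<in> Basis" "b' \<in> Basis" "b \<noteq> b'" "\<rho> b' \<le> \<rho> b" for b b'
  proof -
    obtain i j e where b_eq: "b = axis i (axis j e)" "e \<in> Basis" using b(1) unfolding Basis_matrix by auto
    obtain k l e' where b'_eq: "b' = axis k (axis l e')" "e' \<in> Basis" using b(2) unfolding Basis_matrix by auto
    show ?thesis
    proof (cases "k < i \<or> l < j")
      case True
      then show ?thesis using off by (simp add: b_eq b'_eq inner_axis)
    next
      case False
      then have le: "i \<le> k" "j \<le> l" by auto
      then have "card {..<i} \<le> card {..<k}" "card {..<j} \<le> card {..<l}" by (auto intro!: card_mono)
      moreover have "w k l \<le> w i j" using b(4) by (simp add: b_eq b'_eq \<rho>)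
      ultimately have "card {..<i} = card {..<k}" "card {..<j} = card {..<l}" unfolding w_def by linarith+
      then have "i = k" "j = l"
        using le psubset_card_mono[of "{..<k}" "{..<i}"] psubset_card_mono[of "{..<l}" "{..<j}"]
        by (auto simp: lessThan_strict_subset_iff le_less)
      then show ?thesis
        using b(3) b_eq b'_eq diag by (auto simp: inner_Basis)
    qed
  qed
  have pos: "T b \<bullet> b > 0" if "b \<in> Basis" for b
    using that v(1) u(1) unfolding Basis_matrix by (auto simp: diag)
  show "bij T" by (rule triangular_map_bij[OF T tri pos])
  have "(\<Prod>b\<in>Basis. T b \<bullet> b) = (\<Prod>(i, j, e)\<in>UNIV \<times> UNIV \<times> (Basis :: 'a set). v i * u j)"
    unfolding Basis_matrix
    by (subst prod.reindex[OF inj_on_axis_axis]) (auto intro!: prod.cong simp: diag)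
  also have "\<dots> = (\<Prod>i\<in>UNIV. \<Prod>j\<in>UNIV. (v i * u j) ^ DIM('a))"
    by (simp add: prod.cartesian_product[symmetric])
  also have "\<dots> = (\<Prod>j\<in>UNIV. u j) ^ (CARD('n) * DIM('a)) * (\<Prod>i\<in>UNIV. v i) ^ (CARD('m) * DIM('a))"
  proof -
    have "(\<Prod>i\<in>UNIV. \<Prod>j\<in>UNIV. (v i * u j) ^ DIM('a)) = (\<Prod>i\<in>UNIV. \<Prod>j\<in>UNIV. v i * u j) ^ DIM('a)"
      by (simp only: prod_power_distrib)
    also have "(\<Prod>i\<in>UNIV. \<Prod>j\<in>UNIV. v i * u j) = (\<Prod>i\<in>UNIV. v i ^ CARD('m) * (\<Prod>j\<in>UNIV. u j))"
      by (simp add: prod.distrib)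
    also have "\<dots> = (\<Prod>j\<in>UNIV. u j) ^ CARD('n) * (\<Prod>i\<in>UNIV. v i) ^ CARD('m)"
      by (simp add: prod.distrib mult.commute prod_power_distrib)
    finally show ?thesis by (simp only: power_mult power_mult_distrib)
  qed
  also have "\<dots> = mdet (mstar U \<star> U) powr (real CARD('n) * real DIM('a) / 2) *
      mdet (mstar V \<star> V) powr (real CARD('m) * real DIM('a) / 2)"
  proof -
    have eq: "p ^ k = (p\<^sup>2) powr (real k / 2)" if "p > 0" for p :: real and k
    proof -
      have "(p\<^sup>2) powr (real k / 2) = (p powr 2) powr (real k / 2)"
        using that by (simp only: powr_numeral)
      also have "\<dots> = p powr real k" by (simp only: powr_powr) simp
      also have "\<dots> = p ^ k" by (rule powr_realpow[OF that])
      finally show ?thesis by simp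
    qed
    have "mdet (mstar U \<star> U) = (\<Prod>j\<in>UNIV. u j)\<^sup>2" "mdet (mstar V \<star> V) = (\<Prod>i\<in>UNIV. v i)\<^sup>2"
      by (simp_all add: mdet_gram[OF U] mdet_gram[OF V] u v prod_power_distrib)
    then show ?thesis
      using u(1) v(1) eq[of "\<Prod>j\<in>UNIV. u j" "CARD('n) * DIM('a)"]
        eq[of "\<Prod>i\<in>UNIV. v i" "CARD('m) * DIM('a)"]
      by (simp add: prod_pos)
  qed
  finally show "(\<integral>\<^sup>+x. f x \<partial>lborel) =
        ennreal (mdet (mstar U \<star> U) powr (real CARD('n) * real DIM('a) / 2) *
          mdet (mstar V \<star> V) powr (real CARD('m) * real DIM('a) / 2)) * (\<integral>\<^sup>+x. f (T x) \<partial>lborel)"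
    if "f \<in> borel_measurable borel"
    using nn_integral_lborel_triangular_map[OF T tri pos that] by simp
qed

lemma upper_pos_mone: "upper_pos mone"
  by (auto simp: upper_pos_def mone_def intro!: exI[of _ "1 :: real"])

lemma mstar_mone [simp]: "mstar mone = (mone :: 'a::normed_division_algebra ^ 'n ^ 'n)"
proof -
  have "nda_cnj (1::'a) = 1" using nda_cnj_scaleR_one[of 1] by simp
  then show ?thesis by (auto simp: mstar_def mone_def vec_eq_iff)
qed

lemma bij_mmul_upper_pos:
  fixes U :: "'a::normed_division_algebra ^ 'm::{finite,wellorder} ^ 'm::{finite,wellorder}"
  assumes "upper_pos U"
  shows "bij (\<lambda>Z :: 'a ^ 'm::{finite,wellorder} ^ 'n::{finite,wellorder}. Z \<star> U)"
  using bij_triangular_multiplication[OF upper_pos_mone assms] by simp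

lemma bij_mstar_upper_pos_mmul:
  fixes V :: "'a::normed_division_algebra ^ 'n::{finite,wellorder} ^ 'n::{finite,wellorder}"
  assumes "upper_pos V"
  shows "bij (\<lambda>Z :: 'a ^ 'm::{finite,wellorder} ^ 'n::{finite,wellorder}. mstar V \<star> Z)"
  using bij_triangular_multiplication[OF assms upper_pos_mone] by simp

lemma upper_pos_gram_entry:
  assumes U: "upper_pos U" and r: "U $ i $ i = r *\<^sub>R 1"
  shows "(mstar U \<star> U) $ i $ j = (\<Sum>k\<in>{..<i}. nda_cnj (U $ k $ i) * U $ k $ j) + r *\<^sub>R U $ i $ j"
proof -
  have "(mstar U \<star> U) $ i $ j = (\<Sum>k\<in>UNIV. nda_cnj (U $ k $ i) * U $ k $ j)"
    by (simp add: mmul_def mstar_def)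
  also have "\<dots> = (\<Sum>k\<in>insert i {..<i}. nda_cnj (U $ k $ i) * U $ k $ j)"
  proof (intro sum.mono_neutral_right ballI)
    fix k assume "k \<in> UNIV - insert i {..<i}"
    then have "i < k" by auto
    then show "nda_cnj (U $ k $ i) * U $ k $ j = 0" using U by (simp add: upper_pos_def)
  qed auto
  also have "\<dots> = (\<Sum>k\<in>{..<i}. nda_cnj (U $ k $ i) * U $ k $ j) + r *\<^sub>R U $ i $ j"
    by (simp add: r nda_scaleR_left nda_one_left add.commute)
  finally show ?thesis .
qed

text \<open>
  Row \<open>i\<close> of the Gram matrix determines row \<open>i\<close> of the factor from the rows above it.
\<close>

lemma upper_pos_gram_unique:
  fixes U V :: "'a::normed_division_algebra ^ 'n::{finite,wellorder} ^ 'n::{finite,wellorder}"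
  assumes U: "upper_pos U" and V: "upper_pos V" and eq: "mstar U \<star> U = mstar V \<star> V"
  shows "U = V"
proof -
  have "\<forall>j. U $ i $ j = V $ i $ j" for i
  proof (induction i rule: less_induct)
    case (less i)
    obtain r where r: "r > 0" "U $ i $ i = r *\<^sub>R 1" using U unfolding upper_pos_def by blast
    obtain s where s: "s > 0" "V $ i $ i = s *\<^sub>R 1" using V unfolding upper_pos_def by blast
    have row: "r *\<^sub>R U $ i $ j = s *\<^sub>R V $ i $ j" for j
    proof -
      have "(\<Sum>k\<in>{..<i}. nda_cnj (U $ k $ i) * U $ k $ j) = (\<Sum>k\<in>{..<i}. nda_cnj (V $ k $ i) * V $ k $ j)"
        using less by (intro sum.cong) auto
      then show ?thesis
        using upper_pos_gram_entry[OF U r(2), of j] upper_pos_gram_entry[OF V s(2), of j] eq by simp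
    qed
    have "r * r = s * s" using arg_cong[OF row[of i], of nda_Re] r s by simp
    then have "r = s" using r(1) s(1) by (metis power2_eq_square power2_eq_imp_eq less_imp_le)
    then show ?case using row r(1) by simp
  qed
  then show ?thesis by (simp add: vec_eq_iff)
qed

lemma nda_real_if_cnj_eq: "nda_cnj x = x \<Longrightarrow> x = nda_Re x *\<^sub>R 1"
proof -
  assume "nda_cnj x = x"
  then have "2 *\<^sub>R x = 2 *\<^sub>R (nda_Re x *\<^sub>R 1)" by (simp add: nda_cnj_def scaleR_2 algebra_simps)
  then show ?thesis by (metis scaleR_cancel_left zero_neq_numeral)
qed

text \<open>
  Gaussian elimination along the index list. The Schur complement \<open>B\<close> is again positive definite,
  because its quadratic form at \<open>x\<close> is that of \<open>A\<close> at an extension of \<open>x\<close> to the eliminated index.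
\<close>

lemma cholesky_exists_list:
  fixes A :: "'a::normed_division_algebra ^ 'n::{finite,wellorder} ^ 'n::{finite,wellorder}"
  assumes assoc: "associative_algebra TYPE('a)"
    and "sorted_wrt (<) is"
    and "\<And>j k. j \<in> set is \<Longrightarrow> k \<in> set is \<Longrightarrow> nda_cnj (A $ k $ j) = A $ j $ k"
    and "\<And>x. \<exists>i\<in>set is. x i \<noteq> 0 \<Longrightarrow>
        0 < nda_Re (\<Sum>i\<in>set is. nda_cnj (x i) * (\<Sum>j\<in>set is. A $ i $ j * x j))"
  shows "\<exists>U. (\<forall>i\<in>set is. \<exists>r>0. U $ i $ i = r *\<^sub>R 1) \<and>
    (\<forall>i\<in>set is. \<forall>j\<in>set is. j < i \<longrightarrow> U $ i $ j = 0) \<and>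
    (\<forall>j\<in>set is. \<forall>k\<in>set is. A $ j $ k = (\<Sum>i\<leftarrow>is. nda_cnj (U $ i $ j) * U $ i $ k :: 'a))"
  using assms(2-)
proof (induction "is" arbitrary: A)
  case (Cons i js)
  let ?J = "set js"
  have i: "i \<notin> ?J" and lt: "\<And>j. j \<in> ?J \<Longrightarrow> i < j" using Cons.prems(1) by auto
  define a where "a = nda_Re (A $ i $ i)"
  have Aii: "A $ i $ i = a *\<^sub>R 1" unfolding a_def using Cons.prems(2)[of i i] by (intro nda_real_if_cnj_eq) simp
  have herm: "nda_cnj (A $ k $ j) = A $ j $ k" if "j \<in> insert i ?J" "k \<in> insert i ?J" for j k
    using Cons.prems(2) that by simp
  have a: "a > 0"
  proof -
    let ?x = "\<lambda>j. if j = i then 1 else 0 :: 'a"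
    have "0 < nda_Re (\<Sum>k\<in>set (i # js). nda_cnj (?x k) * (\<Sum>j\<in>set (i # js). A $ k $ j * ?x j))"
      by (rule Cons.prems(3)) auto
    also have "(\<Sum>k\<in>set (i # js). nda_cnj (?x k) * (\<Sum>j\<in>set (i # js). A $ k $ j * ?x j)) =
        (\<Sum>k\<in>set (i # js). if k = i then A $ i $ i else 0)"
    proof (intro sum.cong refl)
      fix k
      have "(\<Sum>j\<in>set (i # js). A $ k $ j * ?x j) = (\<Sum>j\<in>set (i # js). if j = i then A $ k $ i else 0)"
        by (intro sum.cong refl) (auto simp: nda_one_right)
      then have "(\<Sum>j\<in>set (i # js). A $ k $ j * ?x j) = A $ k $ i" by simp
      moreover have "nda_cnj (1::'a) = 1" using nda_cnj_scaleR_one[of 1] by simp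
      ultimately show "nda_cnj (?x k) * (\<Sum>j\<in>set (i # js). A $ k $ j * ?x j) = (if k = i then A $ i $ i else 0)"
        by (auto simp: nda_one_left)
    qed
    finally show ?thesis by (simp add: a_def)
  qed
  define B :: "'a ^ 'n::{finite,wellorder} ^ 'n::{finite,wellorder}" where "B = (\<chi> j k. A $ j $ k - (1 / a) *\<^sub>R (A $ j $ i * A $ i $ k))"
  have "\<exists>U. (\<forall>i\<in>?J. \<exists>r>0. U $ i $ i = r *\<^sub>R 1) \<and> (\<forall>i\<in>?J. \<forall>j\<in>?J. j < i \<longrightarrow> U $ i $ j = 0) \<and>
      (\<forall>j\<in>?J. \<forall>k\<in>?J. B $ j $ k = (\<Sum>i\<leftarrow>js. nda_cnj (U $ i $ j) * U $ i $ k :: 'a))"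
  proof (rule Cons.IH)
    show "sorted_wrt (<) js" using Cons.prems(1) by simp
    show "nda_cnj (B $ k $ j) = B $ j $ k" if "j \<in> ?J" "k \<in> ?J" for j k
      using that by (simp add: B_def nda_cnj_linear nda_cnj_mult herm)
    fix x :: "'n \<Rightarrow> 'a" assume x: "\<exists>i\<in>?J. x i \<noteq> 0"
    \<comment> \<open>The value at \<open>i\<close> that minimises the quadratic form of \<open>A\<close>.\<close>
    define t where "t = (\<Sum>k\<in>?J. A $ i $ k * x k)"
    define y where "y j = (if j = i then - (1 / a) *\<^sub>R t else x j)" for j
    have yJ: "y j = x j" if "j \<in> ?J" for j using that i by (auto simp: y_def)
    have row: "(\<Sum>k\<in>set (i # js). A $ j $ k * y k) = A $ j $ i * y i + (\<Sum>k\<in>?J. A $ j $ k * x k)" for j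
      using i by (simp add: yJ cong: sum.cong)
    have row_i: "(\<Sum>k\<in>set (i # js). A $ i $ k * y k) = 0"
      unfolding row using a by (simp add: Aii y_def t_def nda_scaleR_left nda_one_left)
    have row_j: "(\<Sum>k\<in>set (i # js). A $ j $ k * y k) = (\<Sum>k\<in>?J. B $ j $ k * x k)" for j
    proof -
      have "A $ j $ i * y i = - (\<Sum>k\<in>?J. (1 / a) *\<^sub>R (A $ j $ i * A $ i $ k) * x k)"
        using assoc unfolding associative_algebra_def
        by (simp add: y_def t_def nda_mult.minus_right nda_scaleR_right nda_scaleR_left nda_mult.sum_right
            scaleR_sum_right sum_negf)
      then show ?thesis
        unfolding row by (simp add: B_def nda_mult.diff_left sum_subtractf)
    qed
    have "0 < nda_Re (\<Sum>j\<in>set (i # js). nda_cnj (y j) * (\<Sum>k\<in>set (i # js). A $ j $ k * y k))"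
      using x yJ by (intro Cons.prems(3)) force
    also have "(\<Sum>j\<in>set (i # js). nda_cnj (y j) * (\<Sum>k\<in>set (i # js). A $ j $ k * y k))
        = (\<Sum>j\<in>?J. nda_cnj (y j) * (\<Sum>k\<in>set (i # js). A $ j $ k * y k))"
      using i row_i by simp
    also have "\<dots> = (\<Sum>j\<in>?J. nda_cnj (x j) * (\<Sum>k\<in>?J. B $ j $ k * x k))"
      by (intro sum.cong refl) (simp only: row_j yJ)
    finally show "0 < nda_Re (\<Sum>j\<in>?J. nda_cnj (x j) * (\<Sum>k\<in>?J. B $ j $ k * x k))" .
  qed
  then obtain U where U: "\<And>i. i \<in> ?J \<Longrightarrow> \<exists>r>0. U $ i $ i = r *\<^sub>R 1"
    "\<And>i j. i \<in> ?J \<Longrightarrow> j \<in> ?J \<Longrightarrow> j < i \<Longrightarrow> U $ i $ j = 0"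
    "\<And>j k. j \<in> ?J \<Longrightarrow> k \<in> ?J \<Longrightarrow> B $ j $ k = (\<Sum>i\<leftarrow>js. nda_cnj (U $ i $ j) * U $ i $ k)"
    by blast
  define W :: "'a ^ 'n::{finite,wellorder} ^ 'n::{finite,wellorder}" where
    "W = (\<chi> l k. if l = i then (1 / sqrt a) *\<^sub>R A $ i $ k else if k = i then 0 else U $ l $ k)"
  have Wl: "W $ l $ k = (if k = i then 0 else U $ l $ k)" if "l \<in> ?J" for l k
    using that i by (auto simp: W_def)
  show ?case
  proof (intro exI[of _ W] conjI ballI impI)
    fix l assume l: "l \<in> set (i # js)"
    show "\<exists>r>0. W $ l $ l = r *\<^sub>R 1"
    proof (cases "l = i")
      case True
      then show ?thesis using a by (intro exI[of _ "sqrt a"]) (simp add: W_def Aii real_div_sqrt)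
    next
      case False
      then show ?thesis using U(1)[of l] l Wl by auto
    qed
    fix k assume "k \<in> set (i # js)" "k < l"
    then show "W $ l $ k = 0" using l lt U(2)[of l k] Wl[of l k] by force
  next
    fix j k assume jk: "j \<in> set (i # js)" "k \<in> set (i # js)"
    have first: "nda_cnj (W $ i $ j) * W $ i $ k = (1 / a) *\<^sub>R (A $ j $ i * A $ i $ k)"
      using a jk by (simp add: W_def nda_cnj_linear herm nda_scaleR_left nda_scaleR_right)
    have rest: "(\<Sum>l\<leftarrow>js. nda_cnj (W $ l $ j) * W $ l $ k) = (if j = i \<or> k = i then 0 else B $ j $ k)"
    proof (cases "j = i \<or> k = i")
      case True
      then have "map (\<lambda>l. nda_cnj (W $ l $ j) * W $ l $ k) js = map (\<lambda>l. 0) js"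
        using Wl by (intro map_cong) auto
      then show ?thesis using True by (metis sum_list_0)
    next
      case False
      then have "map (\<lambda>l. nda_cnj (W $ l $ j) * W $ l $ k) js = map (\<lambda>l. nda_cnj (U $ l $ j) * U $ l $ k) js"
        using Wl by (intro map_cong) auto
      then have "(\<Sum>l\<leftarrow>js. nda_cnj (W $ l $ j) * W $ l $ k) = (\<Sum>l\<leftarrow>js. nda_cnj (U $ l $ j) * U $ l $ k)"
        by (simp only:)
      then show ?thesis using False U(3)[of j k] jk by auto
    qed
    show "A $ j $ k = (\<Sum>l\<leftarrow>i # js. nda_cnj (W $ l $ j) * W $ l $ k)"
      using a by (auto simp: first rest B_def Aii nda_scaleR_left nda_scaleR_right nda_one_left nda_one_right)
  qed
qed simp

lemma chol_correct:
  fixes A :: "'a::normed_division_algebra ^ 'n::{finite,wellorder} ^ 'n::{finite,wellorder}"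
  assumes A: "A \<in> pos_def_cone"
  shows "upper_pos (chol A)" and "mstar (chol A) \<star> chol A = A"
proof -
  have "\<exists>U. upper_pos U \<and> A = mstar U \<star> U"
  proof (cases "associative_algebra TYPE('a)")
    case False
    then show ?thesis using A by (simp add: pos_def_cone_def)
  next
    case True
    let ?l = "sorted_list_of_set (UNIV :: 'n set)"
    have "\<exists>U. (\<forall>i\<in>set ?l. \<exists>r>0. U $ i $ i = r *\<^sub>R 1) \<and>
      (\<forall>i\<in>set ?l. \<forall>j\<in>set ?l. j < i \<longrightarrow> U $ i $ j = 0) \<and>
      (\<forall>j\<in>set ?l. \<forall>k\<in>set ?l. A $ j $ k = (\<Sum>i\<leftarrow>?l. nda_cnj (U $ i $ j) * U $ i $ k :: 'a))"
    proof (rule cholesky_exists_list[OF True])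
      show "sorted_wrt (<) ?l" by simp
      show "nda_cnj (A $ k $ j) = A $ j $ k" for j k
        using A by (auto simp: pos_def_cone_def mstar_def vec_eq_iff)
      fix x :: "'n \<Rightarrow> 'a" assume "\<exists>i\<in>set ?l. x i \<noteq> 0"
      then have "(\<chi> i. x i) \<noteq> 0" by (auto simp: vec_eq_iff)
      then show "0 < nda_Re (\<Sum>i\<in>set ?l. nda_cnj (x i) * (\<Sum>j\<in>set ?l. A $ i $ j * x j))"
        using A True unfolding pos_def_cone_def by (auto simp: mvec_def)
    qed
    then show ?thesis
      by (auto simp: upper_pos_def vec_eq_iff mmul_def mstar_def sum_list_distinct_conv_sum_set)
  qed
  then have "\<exists>!U. upper_pos U \<and> A = mstar U \<star> U"
    using upper_pos_gram_unique by metis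
  from theI'[OF this] show "upper_pos (chol A)" and "mstar (chol A) \<star> chol A = A"
    unfolding chol_def by auto
qed

lemma minv_eqI:
  fixes A B :: "'a::normed_division_algebra ^ 'n ^ 'n"
  assumes assoc: "associative_algebra TYPE('a)" and AB: "A \<star> B = mone" and BA: "B \<star> A = mone"
  shows "minv A = B"
proof -
  have "is_minv A B" using assms by (simp add: is_minv_def)
  moreover have "C = B" if "is_minv A C" for C
  proof -
    have "C = (B \<star> A) \<star> C" by (simp add: BA)
    also have "\<dots> = B \<star> (A \<star> C)" by (rule mmul_assoc[OF assoc])
    also have "\<dots> = B" using that assoc by (simp add: is_minv_def)
    finally show ?thesis .
  qed
  ultimately have "\<exists>!B. is_minv A B" "(THE B. is_minv A B) = B" by - (rule ex1I, assumption, blast, rule the_equality)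
  then show ?thesis unfolding minv_def by (simp only: if_True)
qed

lemma upper_pos_invertible:
  fixes U :: "'a::normed_division_algebra ^ 'n::{finite,wellorder} ^ 'n::{finite,wellorder}"
  assumes assoc: "associative_algebra TYPE('a)" and U: "upper_pos U"
  obtains P where "P \<star> U = mone" "U \<star> P = mone"
proof -
  have bij: "bij (\<lambda>Z :: 'a ^ 'n::{finite,wellorder} ^ 'n::{finite,wellorder}. Z \<star> U)" by (rule bij_mmul_upper_pos[OF U])
  then obtain P where P: "P \<star> U = mone" by (metis bij_pointE)
  have "(U \<star> P) \<star> U = mone \<star> U" by (simp add: mmul_assoc[OF assoc] P)
  then have "U \<star> P = mone" using bij by (meson bij_is_inj injD)
  with P show ?thesis by (rule that)
qed

text \<open>
  In the associative case the triangular factors cancel against their inverses, up to a cyclic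
  permutation under the trace. In the nonassociative case the quotients are undone in the order in
  which the products were formed, by injectivity of one-sided triangular multiplication.
\<close>

lemma kr_args_of_image:
  fixes \<Theta> :: "'a::normed_division_algebra ^ 'n::{finite,wellorder} ^ 'n::{finite,wellorder}"
    and Z :: "'a ^ 'm::{finite,wellorder} ^ 'n::{finite,wellorder}"
  assumes \<Theta>: "\<Theta> \<in> pos_def_cone" and \<Sigma>: "\<Sigma> \<in> pos_def_cone"
  defines "Y \<equiv> mstar (chol \<Theta>) \<star> Z \<star> chol \<Sigma>"
  shows kr_power_arg_of_image: "kr_power_arg \<Theta> \<Sigma> Y = mstar Z \<star> Z"
    and mtrace_kr_trace_arg_of_image: "mtrace (kr_trace_arg \<Theta> \<Sigma> Y) = mtrace (mstar Z \<star> Z)"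
proof -
  define V where "V = chol \<Theta>"
  define U where "U = chol \<Sigma>"
  have V: "upper_pos V" "\<Theta> = mstar V \<star> V" and U: "upper_pos U" "\<Sigma> = mstar U \<star> U"
    using chol_correct[OF \<Theta>] chol_correct[OF \<Sigma>] by (simp_all add: V_def U_def)
  have Y: "Y = mstar V \<star> Z \<star> U" by (simp add: Y_def V_def U_def)
  have "kr_power_arg \<Theta> \<Sigma> Y = mstar Z \<star> Z \<and> mtrace (kr_trace_arg \<Theta> \<Sigma> Y) = mtrace (mstar Z \<star> Z)"
  proof (cases "associative_algebra TYPE('a)")
    case False
    have "rdivide Y U = mstar V \<star> Z"
      unfolding rdivide_def Y
      using bij_is_inj[OF bij_mmul_upper_pos[OF U(1)]] by (auto intro!: the_equality dest: injD)
    moreover have "ldivide (mstar V) (mstar V \<star> Z) = Z"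
      unfolding ldivide_def
      using bij_is_inj[OF bij_mstar_upper_pos_mmul[OF V(1)]] by (auto intro!: the_equality dest: injD)
    ultimately show ?thesis
      using False by (simp add: kr_power_arg_def kr_trace_arg_def octonionic_gram_def flip: V_def U_def)
  next
    case True
    note assoc = mmul_assoc[OF True]
    obtain P where P: "P \<star> U = mone" "U \<star> P = mone" using upper_pos_invertible[OF True U(1)] .
    obtain Q where Q: "Q \<star> V = mone" "V \<star> Q = mone" using upper_pos_invertible[OF True V(1)] .
    have Ps: "mstar U \<star> mstar P = mone" "mstar P \<star> mstar U = mone"
      using P by (simp_all flip: mstar_mmul)
    have Qs: "mstar V \<star> mstar Q = mone" "mstar Q \<star> mstar V = mone"
      using Q by (simp_all flip: mstar_mmul)
    have cancel: "A \<star> (B \<star> C) = C" if "A \<star> B = mone" for A B :: "'a ^ 'k ^ 'k" and C :: "'a ^ 'l ^ 'k"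
      using that by (simp flip: assoc)
    have inv: "minv U = P" "minv (mstar U) = mstar P" "minv \<Sigma> = P \<star> mstar P" "minv \<Theta> = Q \<star> mstar Q"
      using P Q Ps Qs by (intro minv_eqI[OF True]; simp add: U(2) V(2) assoc cancel)+
    have Ystar: "mstar Y = mstar U \<star> (mstar Z \<star> V)" by (simp add: Y mstar_mmul)
    have "mtrace (P \<star> (mstar Z \<star> (Z \<star> U))) = mtrace (mstar Z \<star> Z)"
      by (subst mtrace_commute) (simp add: assoc P)
    then show ?thesis
      using True P Ps Q Qs
      by (simp add: kr_power_arg_def kr_trace_arg_def inv Ystar flip: U_def)
        (simp add: Y assoc cancel[OF Ps(2)] cancel[OF Q(2)] cancel[OF Qs(2)] cancel[OF P(2)] P)
  qed
  then show "kr_power_arg \<Theta> \<Sigma> Y = mstar Z \<star> Z"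
    and "mtrace (kr_trace_arg \<Theta> \<Sigma> Y) = mtrace (mstar Z \<star> Z)" by auto
qed

section \<open>Homogeneity and measurability of the generalised power\<close>

lemma hdet_scaleR:
  fixes A :: "'a::normed_division_algebra ^ 'n ^ 'n"
  assumes "c \<noteq> 0"
  shows "hdet is (c *\<^sub>R A) = c ^ length is * hdet is A"
proof (induction "is" arbitrary: A)
  case (Cons i js)
  define B where "B = (\<chi> j k. A $ j $ k - (1 / nda_Re (A $ i $ i)) *\<^sub>R (A $ j $ i * A $ i $ k))"
  have "(\<chi> j k. (c *\<^sub>R A) $ j $ k - (1 / nda_Re ((c *\<^sub>R A) $ i $ i)) *\<^sub>R ((c *\<^sub>R A) $ j $ i * (c *\<^sub>R A) $ i $ k)) = c *\<^sub>R B"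
    using assms by (simp add: B_def vec_eq_iff nda_Re_linear nda_scaleR_left nda_scaleR_right scaleR_diff_right)
  then show ?case using Cons.IH[of B] by (simp add: nda_Re_linear flip: B_def)
qed simp

lemma minor_scaleR:
  fixes A :: "'a::normed_division_algebra ^ 'n::{finite,wellorder} ^ 'n::{finite,wellorder}"
  assumes "c \<noteq> 0" "p \<le> CARD('n)"
  shows "minor p (c *\<^sub>R A) = c ^ p * minor p A"
  using assms by (simp add: minor_def hdet_scaleR min_absorb2)

lemma sum_by_parts_weights:
  fixes k :: "nat \<Rightarrow> real"
  assumes "M \<ge> 1"
  shows "real M * k M + (\<Sum>i=1..<M. real i * (k i - k (i + 1))) = (\<Sum>i=1..M. k i)"
  using assms
proof (induction M rule: dec_induct)
  case (step M)
  then show ?case by (simp add: algebra_simps)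
qed simp

lemma sum_kap:
  fixes \<kappa> :: "real ^ 'm::{finite,wellorder}"
  shows "(\<Sum>i=1..CARD('m). kap \<kappa> i) = (\<Sum>i\<in>UNIV. \<kappa> $ i)"
proof -
  let ?l = "sorted_list_of_set (UNIV :: 'm set)"
  have "(\<Sum>i=1..CARD('m). kap \<kappa> i) = (\<Sum>i<CARD('m). \<kappa> $ (?l ! i))"
    unfolding kap_def by (rule sum.reindex_bij_witness[of _ Suc "\<lambda>i. i - 1"]) auto
  also have "\<dots> = (\<Sum>i\<leftarrow>?l. \<kappa> $ i)"
    by (simp add: sum_list_sum_nth atLeast0LessThan)
  also have "\<dots> = (\<Sum>i\<in>UNIV. \<kappa> $ i)"
    by (simp add: sum_list_distinct_conv_sum_set)
  finally show ?thesis .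
qed

text \<open>
  A leading minor of order \<open>p\<close> has degree \<open>p\<close>, and summation by parts adds up the exponents. The
  minors may have any sign here: real powers depend on the absolute value of the base only.
\<close>

lemma gen_power_scaleR:
  fixes A :: "'a::normed_division_algebra ^ 'm::{finite,wellorder} ^ 'm::{finite,wellorder}"
  assumes c: "c > 0"
  shows "gen_power \<kappa> (c *\<^sub>R A) = c powr (\<Sum>i\<in>UNIV. \<kappa> $ i) * gen_power \<kappa> A"
proof -
  have pw: "minor p (c *\<^sub>R A) powr e = c powr (real p * e) * minor p A powr e" if "p \<le> CARD('m)" for p e
    using c that by (simp add: minor_scaleR powr_mult powr_powr flip: powr_realpow)
  have "gen_power \<kappa> (c *\<^sub>R A) = (c powr (real CARD('m) * kap \<kappa> CARD('m)) *
      (\<Prod>i=1..<CARD('m). c powr (real i * (kap \<kappa> i - kap \<kappa> (i + 1))))) * gen_power \<kappa> A"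
    by (simp add: gen_power_def pw prod.distrib)
  also have "c powr (real CARD('m) * kap \<kappa> CARD('m)) *
      (\<Prod>i=1..<CARD('m). c powr (real i * (kap \<kappa> i - kap \<kappa> (i + 1))))
      = c powr (real CARD('m) * kap \<kappa> CARD('m) + (\<Sum>i=1..<CARD('m). real i * (kap \<kappa> i - kap \<kappa> (i + 1))))"
    using c by (simp only: powr_add powr_sum[OF less_imp_neq[OF c, symmetric]])
  also have "\<dots> = c powr (\<Sum>i\<in>UNIV. \<kappa> $ i)"
    using sum_by_parts_weights[of "CARD('m)" "kap \<kappa>"] by (simp add: sum_kap[unfolded One_nat_def] Suc_le_eq)
  finally show ?thesis .
qed

lemma is_minv_scaleR:
  "is_minv (c *\<^sub>R A) B \<longleftrightarrow> is_minv A (c *\<^sub>R B)" if "c \<noteq> 0"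
  using that
  by (simp add: is_minv_def bilinear_lmul[OF bilinear_mmul] bilinear_rmul[OF bilinear_mmul]
      linear_cmul[OF linear_mstar])

lemma minv_scaleR:
  assumes c: "c \<noteq> 0"
  shows "minv (c *\<^sub>R A) = (1 / c) *\<^sub>R minv A"
proof (cases "\<exists>!B. is_minv A B")
  case True
  then obtain B where B: "is_minv A B" "\<And>C. is_minv A C \<Longrightarrow> C = B" by metis
  have "is_minv (c *\<^sub>R A) ((1 / c) *\<^sub>R B)" using B(1) c by (simp add: is_minv_scaleR)
  moreover have "C = (1 / c) *\<^sub>R B" if "is_minv (c *\<^sub>R A) C" for C
    using B(2)[of "c *\<^sub>R C"] that c by (auto simp: is_minv_scaleR)
  ultimately have "\<exists>!B. is_minv (c *\<^sub>R A) B" "(THE B. is_minv (c *\<^sub>R A) B) = (1 / c) *\<^sub>R B"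
    by - (rule ex1I, assumption, blast, rule the_equality)
  moreover have "(THE B. is_minv A B) = B" using B by (rule the_equality)
  ultimately show ?thesis using True unfolding minv_def by (simp only: if_True)
next
  case False
  have "\<not> (\<exists>!B. is_minv (c *\<^sub>R A) B)"
  proof
    assume "\<exists>!B. is_minv (c *\<^sub>R A) B"
    then obtain B where B: "is_minv (c *\<^sub>R A) B" "\<And>C. is_minv (c *\<^sub>R A) C \<Longrightarrow> C = B" by metis
    have "is_minv A (c *\<^sub>R B)" using B(1) c by (simp add: is_minv_scaleR)
    moreover have "C = c *\<^sub>R B" if "is_minv A C" for C
      using B(2)[of "(1 / c) *\<^sub>R C"] that c by (auto simp: is_minv_scaleR)
    ultimately show False using False by blast
  qed
  with False show ?thesis by (simp add: minv_def)
qed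

lemma borel_measurable_matrix:
  fixes f :: "'w \<Rightarrow> 'a::euclidean_space ^ 'm ^ 'n"
  assumes "\<And>i j. (\<lambda>x. f x $ i $ j) \<in> borel_measurable M"
  shows "f \<in> borel_measurable M"
  unfolding borel_measurable_euclidean_space[of f] Basis_matrix
  using assms by (auto simp: inner_axis intro!: borel_measurable_inner)

lemma borel_measurable_hdet:
  "hdet is \<in> borel_measurable (borel :: ('a::normed_division_algebra ^ 'n ^ 'n) measure)"
proof (induction "is")
  case (Cons i js)
  have entry: "(\<lambda>A :: 'a ^ 'n ^ 'n. A $ j $ k) \<in> borel_measurable borel" for j k
    by (intro borel_measurable_continuous_onI continuous_intros)
  have re: "(\<lambda>A :: 'a ^ 'n ^ 'n. nda_Re (A $ i $ i)) \<in> borel_measurable borel"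
    unfolding nda_Re_def using entry by (intro borel_measurable_inner borel_measurable_const)
  have "(\<lambda>A :: 'a ^ 'n ^ 'n. A $ j $ i * A $ i $ k) \<in> borel_measurable borel" for j k
    by (intro borel_measurable_continuous_onI nda_mult.continuous_on continuous_intros)
  then have "(\<lambda>A :: 'a ^ 'n ^ 'n. \<chi> j k. A $ j $ k - (1 / nda_Re (A $ i $ i)) *\<^sub>R (A $ j $ i * A $ i $ k))
      \<in> borel_measurable borel"
    using entry re by (intro borel_measurable_matrix) simp
  from measurable_compose[OF this Cons] re show ?case
    by (simp add: borel_measurable_times)
qed simp

lemma borel_measurable_gen_power: "gen_power \<kappa> \<in> borel_measurable borel"
  using borel_measurable_hdet unfolding gen_power_def minor_def
  by (intro borel_measurable_times borel_measurable_prod powr_real_measurable borel_measurable_const) auto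

lemma continuous_on_mmul [continuous_intros]:
  fixes f :: "_ \<Rightarrow> 'a::normed_division_algebra ^ 'k ^ 'n" and g :: "_ \<Rightarrow> 'a ^ 'm ^ 'k"
  shows "continuous_on S f \<Longrightarrow> continuous_on S g \<Longrightarrow> continuous_on S (\<lambda>x. f x \<star> g x)"
  using bilinear_conv_bounded_bilinear[of "(\<star>) :: 'a ^ 'k ^ 'n \<Rightarrow> 'a ^ 'm ^ 'k \<Rightarrow> _"] bilinear_mmul
    bounded_bilinear.continuous_on by blast

text \<open>
  The relation \<open>is_minv\<close> is closed. The matrices that have an inverse in a given closed set, and
  those that have two distinct inverses, are therefore countable unions of projections of closed sets.
\<close>

lemma borel_measurable_minv:
  "minv \<in> borel_measurable (borel :: ('a::normed_division_algebra ^ 'n ^ 'n) measure)"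
proof -
  let ?G = "{p :: ('a ^ 'n ^ 'n) \<times> ('a ^ 'n ^ 'n). is_minv (fst p) (snd p)}"
  have G: "closed ?G"
  proof (cases "associative_algebra TYPE('a)")
    case True
    then show ?thesis
      unfolding is_minv_def
      by (simp, intro closed_Collect_conj closed_Collect_eq continuous_intros)
  next
    case False
    then show ?thesis
      unfolding is_minv_def
      by (simp, intro closed_Collect_conj closed_Collect_eq continuous_intros)
  qed
  define N where "N k = {p :: ('a ^ 'n ^ 'n) \<times> ('a ^ 'n ^ 'n) \<times> ('a ^ 'n ^ 'n).
      is_minv (fst p) (fst (snd p)) \<and> is_minv (fst p) (snd (snd p)) \<and>
      1 / Suc k \<le> dist (fst (snd p)) (snd (snd p))}" for k :: nat
  have "closed (N k)" for k
  proof -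
    have "closed ((\<lambda>p. (fst p, fst (snd p))) -` ?G)" "closed ((\<lambda>p. (fst p, snd (snd p))) -` ?G)"
      "closed {p :: ('a ^ 'n ^ 'n) \<times> ('a ^ 'n ^ 'n) \<times> ('a ^ 'n ^ 'n). 1 / Suc k \<le> dist (fst (snd p)) (snd (snd p))}"
      by (intro closed_vimage G closed_Collect_le continuous_intros)+
    then have "closed ((\<lambda>p. (fst p, fst (snd p))) -` ?G \<inter> (\<lambda>p. (fst p, snd (snd p))) -` ?G \<inter>
        {p. 1 / Suc k \<le> dist (fst (snd p)) (snd (snd p))})"
      by (rule closed_Int[OF closed_Int])
    moreover have "N k = (\<lambda>p. (fst p, fst (snd p))) -` ?G \<inter> (\<lambda>p. (fst p, snd (snd p))) -` ?G \<inter>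
        {p. 1 / Suc k \<le> dist (fst (snd p)) (snd (snd p))}"
      unfolding N_def by auto
    ultimately show ?thesis by simp
  qed
  then have N: "(\<Union>k. fst ` N k) \<in> sets borel"
    by (intro sets.countable_UN image_subsetI projection_of_closed_borel)
  have proj: "fst ` (?G \<inter> UNIV \<times> C) \<in> sets borel" if "closed C" for C
    using G that by (intro projection_of_closed_borel closed_Int closed_Times closed_UNIV)
  have unique: "(\<exists>!B. is_minv A B) \<longleftrightarrow> A \<in> fst ` (?G \<inter> UNIV \<times> UNIV) \<and> A \<notin> (\<Union>k. fst ` N k)" for A
  proof -
    have "A \<in> (\<Union>k. fst ` N k) \<longleftrightarrow> (\<exists>B C. is_minv A B \<and> is_minv A C \<and> B \<noteq> C)"
    proof
      assume "\<exists>B C. is_minv A B \<and> is_minv A C \<and> B \<noteq> C"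
      then obtain B C where BC: "is_minv A B" "is_minv A C" "B \<noteq> C" by blast
      then obtain k where "1 / Suc k < dist B C" using nat_approx_posE[of "dist B C"] by auto
      then have "(A, B, C) \<in> N k" using BC by (simp add: N_def)
      then show "A \<in> (\<Union>k. fst ` N k)" by force
    next
      assume "A \<in> (\<Union>k. fst ` N k)"
      then obtain k B C where p: "(A, B, C) \<in> N k" by auto
      then have "is_minv A B" "is_minv A C" "1 / Suc k \<le> dist B C" unfolding N_def by auto
      moreover from this have "B \<noteq> C" by auto
      ultimately show "\<exists>B C. is_minv A B \<and> is_minv A C \<and> B \<noteq> C" by blast
    qed
    moreover have "A \<in> fst ` (?G \<inter> UNIV \<times> UNIV) \<longleftrightarrow> (\<exists>B. is_minv A B)"
      by (auto simp: image_iff Bex_def)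
    ultimately show ?thesis by blast
  qed
  define I where "I = {A :: 'a ^ 'n ^ 'n. \<exists>!B. is_minv A B}"
  have I: "I = fst ` (?G \<inter> UNIV \<times> UNIV) - (\<Union>k. fst ` N k)"
    unfolding I_def using unique by blast
  have I_borel: "I \<in> sets borel"
    unfolding I using N proj[OF closed_UNIV] by (rule sets.Diff[rotated])
  have vimage_closed_borel: "minv -` C \<in> sets borel" if C: "closed C" for C :: "('a ^ 'n ^ 'n) set"
  proof -
    have in_I: "minv A \<in> C \<longleftrightarrow> A \<in> fst ` (?G \<inter> UNIV \<times> C)" if "A \<in> I" for A
    proof -
      have ex1: "\<exists>!B. is_minv A B" using that by (simp add: I_def)
      then obtain B where B: "is_minv A B" "\<And>D. is_minv A D \<Longrightarrow> D = B" by metis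
      have "minv A = B" using ex1 the1_equality[OF ex1 B(1)] by (simp add: minv_def)
      moreover have "A \<in> fst ` (?G \<inter> UNIV \<times> C) \<longleftrightarrow> (\<exists>D\<in>C. is_minv A D)" by force
      ultimately show ?thesis using B by blast
    qed
    have not_in_I: "minv A = 0" if "A \<notin> I" for A
      using that by (simp add: I_def minv_def)
    have "minv -` C = (I \<inter> fst ` (?G \<inter> UNIV \<times> C)) \<union> (if 0 \<in> C then - I else {})"
    proof (rule set_eqI)
      fix A
      show "A \<in> minv -` C \<longleftrightarrow> A \<in> (I \<inter> fst ` (?G \<inter> UNIV \<times> C)) \<union> (if 0 \<in> C then - I else {})"
        by (cases "A \<in> I") (simp_all add: in_I not_in_I)
    qed
    also have "\<dots> \<in> sets borel"
      using I_borel proj[OF C] borel_comp[OF I_borel] by auto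
    finally show ?thesis .
  qed
  show ?thesis
  proof (rule borel_measurableI)
    fix S :: "('a ^ 'n ^ 'n) set" assume "open S"
    then have "- (minv -` (- S)) \<in> sets borel"
      by (intro borel_comp vimage_closed_borel) (simp add: closed_def)
    then show "minv -` S \<inter> space borel \<in> sets borel" by (simp add: vimage_Compl)
  qed
qed

text \<open>
  Change of variables for densities restricted to a conull set \<open>D\<close>. The density of the image is again
  restricted to \<open>D\<close> and not to the image of \<open>D\<close>; this is harmless because the preimage of the null
  set \<open>- D\<close> under \<open>T\<close> is null by the scaling property.
\<close>

lemma has_density_on_image:
  fixes T :: "'b::euclidean_space \<Rightarrow> 'b"
  assumes Z: "has_density_on M Z D f"
    and D: "D \<in> sets borel" "- D \<in> null_sets lborel"
    and T: "T \<in> borel_measurable borel"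
    and scale: "\<And>h. h \<in> borel_measurable borel \<Longrightarrow> (\<integral>\<^sup>+x. h x \<partial>lborel) = ennreal c * (\<integral>\<^sup>+x. h (T x) \<partial>lborel)"
    and c: "c > 0"
    and g: "g \<in> borel_measurable borel" "\<And>z. g (T z) = f z / c"
  shows "has_density_on M (\<lambda>w. T (Z w)) D g"
proof -
  define F where "F z = ennreal (f z * indicator D z)" for z
  define G where "G x = ennreal (g x * indicator D x)" for x
  have Z_meas: "Z \<in> measurable M lborel" and F: "F \<in> borel_measurable borel"
    and distr: "distr M lborel Z = density lborel F"
    using Z unfolding has_density_on_def distributed_def F_def[symmetric] by auto
  have G: "G \<in> borel_measurable borel" unfolding G_def using g D by measurable
  have GA: "(\<lambda>x. G x * indicator A x) \<in> borel_measurable borel" if "A \<in> sets borel" for A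
    using G that by measurable
  have AE1: "AE z in lborel. z \<in> D" using AE_not_in[OF D(2)] by simp
  have AE2: "AE z in lborel. T z \<in> D"
  proof -
    have "ennreal c * (\<integral>\<^sup>+z. indicator (- D) (T z) \<partial>lborel) = (\<integral>\<^sup>+z. indicator (- D) z \<partial>lborel)"
      using D by (intro scale[symmetric]) auto
    also have "\<dots> = 0" using D by auto
    finally have "(\<integral>\<^sup>+z. indicator (- D) (T z) \<partial>lborel) = 0" using c by simp
    moreover have "(\<lambda>z. indicator (- D) (T z) :: ennreal) \<in> borel_measurable lborel"
      using T D by measurable
    ultimately have "AE z in lborel. (indicator (- D) (T z) :: ennreal) = 0"
      by (simp add: nn_integral_0_iff_AE)
    then show ?thesis by eventually_elim (auto simp: indicator_def split: if_splits)
  qed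
  have "distr M lborel (\<lambda>w. T (Z w)) = density lborel G"
  proof (rule measure_eqI)
    fix A assume "A \<in> sets (distr M lborel (\<lambda>w. T (Z w)))"
    then have A: "A \<in> sets borel" by simp
    have "emeasure (distr M lborel (\<lambda>w. T (Z w))) A = emeasure (distr (distr M lborel Z) lborel T) A"
      using Z_meas T by (subst distr_distr) (auto simp: o_def)
    also have "\<dots> = emeasure (density lborel F) (T -` A)"
      unfolding distr using T A by (subst emeasure_distr) auto
    also have "\<dots> = (\<integral>\<^sup>+z. F z * indicator (T -` A) z \<partial>lborel)"
      using F measurable_sets_borel[OF T A] by (intro emeasure_density) auto
    also have "\<dots> = (\<integral>\<^sup>+z. ennreal c * (G (T z) * indicator A (T z)) \<partial>lborel)"
    proof (rule nn_integral_cong_AE)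
      show "AE z in lborel. F z * indicator (T -` A) z = ennreal c * (G (T z) * indicator A (T z))"
        using AE1 AE2
      proof eventually_elim
        case (elim z)
        have "F z = ennreal c * G (T z)"
          using elim c by (simp add: F_def G_def g flip: ennreal_mult')
        then show ?case by (simp add: indicator_def mult.assoc)
      qed
    qed
    also have "\<dots> = ennreal c * (\<integral>\<^sup>+z. G (T z) * indicator A (T z) \<partial>lborel)"
      using measurable_compose[OF T GA[OF A]] by (intro nn_integral_cmult) simp
    also have "\<dots> = (\<integral>\<^sup>+x. G x * indicator A x \<partial>lborel)"
      by (rule scale[OF GA[OF A], symmetric])
    also have "\<dots> = emeasure (density lborel G) A"
      using G A by (intro emeasure_density[symmetric]) auto
    finally show "emeasure (distr M lborel (\<lambda>w. T (Z w))) A = emeasure (density lborel G) A" .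
  qed simp
  moreover have "(\<lambda>w. T (Z w)) \<in> measurable M lborel"
    using measurable_compose[OF Z_meas] T by simp
  ultimately show ?thesis
    using G unfolding has_density_on_def distributed_def G_def by simp
qed

section \<open>The elliptical densities\<close>

lemma has_density_on_triangular_image:
  fixes Z :: "'w \<Rightarrow> 'a::normed_division_algebra ^ 'm::{finite,wellorder} ^ 'n::{finite,wellorder}"
  assumes le: "CARD('m) \<le> CARD('n)"
    and \<Sigma>: "\<Sigma> \<in> pos_def_cone" and \<Theta>: "\<Theta> \<in> pos_def_cone"
    and Z: "has_density_on M Z full_rank_distinct f" and f: "f \<in> borel_measurable borel"
    and g: "\<And>z. g (\<mu> + mstar (chol \<Theta>) \<star> z \<star> chol \<Sigma>) = f z /
      (mdet \<Sigma> powr (real CARD('n) * real DIM('a) / 2) * mdet \<Theta> powr (real CARD('m) * real DIM('a) / 2))"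
  shows "has_density_on M (\<lambda>w. \<mu> + mstar (chol \<Theta>) \<star> Z w \<star> chol \<Sigma>) full_rank_distinct g"
proof -
  define T0 where "T0 z = mstar (chol \<Theta>) \<star> z \<star> chol \<Sigma>" for z :: "'a ^ 'm::{finite,wellorder} ^ 'n::{finite,wellorder}"
  define c where "c = mdet \<Sigma> powr (real CARD('n) * real DIM('a) / 2) * mdet \<Theta> powr (real CARD('m) * real DIM('a) / 2)"
  note V = chol_correct[OF \<Theta>] and U = chol_correct[OF \<Sigma>]
  have T0: "linear T0" "bij T0" and T0_scale: "\<And>h. h \<in> borel_measurable borel \<Longrightarrow>
      (\<integral>\<^sup>+x. h x \<partial>lborel) = ennreal c * (\<integral>\<^sup>+x. h (T0 x) \<partial>lborel)"
    using triangular_multiplication[OF V(1) U(1)] unfolding T0_def[abs_def] c_def V(2) U(2) by auto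
  have "mdet (mstar W \<star> W) > 0" if "upper_pos W" for W :: "'a ^ 'k::{finite,wellorder} ^ 'k::{finite,wellorder}"
  proof -
    have "nda_Re (W $ i $ i) \<noteq> 0" for i using that unfolding upper_pos_def by (metis nda_Re_scaleR_one less_irrefl)
    then show ?thesis by (simp add: mdet_gram[OF that] prod_pos)
  qed
  from this[OF V(1)] this[OF U(1)] have c: "c > 0" by (simp add: c_def V(2) U(2))
  obtain S0 where S0: "linear S0" "\<And>x. T0 (S0 x) = x" "\<And>x. S0 (T0 x) = x"
    using linear_injective_isomorphism[OF T0(1) bij_is_inj[OF T0(2)]] by blast
  have cont: "continuous_on UNIV T0" "continuous_on UNIV S0"
    using T0(1) S0(1) by (simp_all add: linear_continuous_on linear_conv_bounded_linear)
  have g_eq: "g = (\<lambda>x. f (S0 (x - \<mu>)) / c)"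
  proof
    fix x
    have "x = \<mu> + mstar (chol \<Theta>) \<star> S0 (x - \<mu>) \<star> chol \<Sigma>"
      using S0(2)[of "x - \<mu>"] by (simp add: T0_def)
    then show "g x = f (S0 (x - \<mu>)) / c" using g[of "S0 (x - \<mu>)"] by (simp add: c_def)
  qed
  have "has_density_on M (\<lambda>w. \<mu> + T0 (Z w)) full_rank_distinct g"
  proof (rule has_density_on_image[OF Z full_rank_distinct_borel full_rank_distinct_conull[OF le] _ _ c])
    show "(\<lambda>z. \<mu> + T0 z) \<in> borel_measurable borel"
      by (intro borel_measurable_continuous_onI continuous_intros cont)
    have "(\<lambda>x. S0 (x - \<mu>)) \<in> borel_measurable borel"
      by (intro borel_measurable_continuous_onI continuous_on_compose2[OF cont(2)] continuous_intros) auto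
    from measurable_compose[OF this f] show "g \<in> borel_measurable borel"
      unfolding g_eq by (intro borel_measurable_divide borel_measurable_const)
    show "g (\<mu> + T0 z) = f z / c" for z using g by (simp add: T0_def c_def)
    fix h :: "'a ^ 'm::{finite,wellorder} ^ 'n::{finite,wellorder} \<Rightarrow> ennreal" assume h: "h \<in> borel_measurable borel"
    have "(\<integral>\<^sup>+x. h x \<partial>lborel) = (\<integral>\<^sup>+x. h x \<partial>distr lborel borel ((+) \<mu>))" by (simp add: lborel_distr_plus)
    also have "\<dots> = (\<integral>\<^sup>+x. h (\<mu> + x) \<partial>lborel)" using h by (intro nn_integral_distr) auto
    also have "\<dots> = ennreal c * (\<integral>\<^sup>+x. h (\<mu> + T0 x) \<partial>lborel)"
      by (intro T0_scale measurable_compose[OF _ h] borel_measurable_continuous_onI continuous_intros)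
    finally show "(\<integral>\<^sup>+x. h x \<partial>lborel) = ennreal c * (\<integral>\<^sup>+x. h (\<mu> + T0 x) \<partial>lborel)" .
  qed
  then show ?thesis by (simp add: T0_def)
qed

theorem theorem4p1:
  fixes M :: "'w measure"
    and Z :: "'w \<Rightarrow> 'a::normed_division_algebra ^ 'm::{finite,wellorder} ^ 'n::{finite,wellorder}"
    and \<mu> :: "'a ^ 'm::{finite,wellorder} ^ 'n::{finite,wellorder}"
    and \<Sigma> :: "'a ^ 'm::{finite,wellorder} ^ 'm::{finite,wellorder}"
    and \<Theta> :: "'a ^ 'n::{finite,wellorder} ^ 'n::{finite,wellorder}"
    and \<kappa> :: "real ^ 'm::{finite,wellorder}"
  defines "\<beta> \<equiv> real DIM('a)" and "m \<equiv> real CARD('m)" and "n \<equiv> real CARD('n)"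
    and "X \<equiv> \<lambda>w. \<mu> + mstar (chol \<Theta>) \<star> Z w \<star> chol \<Sigma>"
  assumes "prob_space M"
    and "CARD('m) \<le> CARD('n)"
    and "\<Sigma> \<in> pos_def_cone" and "\<Theta> \<in> pos_def_cone"
    and "\<mu> \<in> full_rank_distinct"
  shows "(n * \<beta> / 2 > (m - 1) * \<beta> / 2 - kap \<kappa> CARD('m) \<and> spherical_kotz_riesz_I M \<kappa> Z \<longrightarrow>
      has_density_on M X full_rank_distinct (\<lambda>x.
        \<beta> powr (m * n * \<beta> / 2 + (\<Sum>i\<in>UNIV. \<kappa> $ i)) * mgamma TYPE('a) TYPE('m) (n * \<beta> / 2) /
          (pi powr (m * n * \<beta> / 2) * mgamma_pos TYPE('a) (n * \<beta> / 2) \<kappa> *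
            mdet \<Sigma> powr (n * \<beta> / 2) * mdet \<Theta> powr (m * \<beta> / 2)) *
        exp (- \<beta> * mtrace (kr_trace_arg \<Theta> \<Sigma> (x - \<mu>))) *
        gen_power \<kappa> (kr_power_arg \<Theta> \<Sigma> (x - \<mu>))))
    \<and> (n * \<beta> / 2 > (m - 1) * \<beta> / 2 + kap \<kappa> 1 \<and> spherical_kotz_riesz_II M \<kappa> Z \<longrightarrow>
      has_density_on M X full_rank_distinct (\<lambda>x.
        \<beta> powr (m * n * \<beta> / 2 - (\<Sum>i\<in>UNIV. \<kappa> $ i)) * mgamma TYPE('a) TYPE('m) (n * \<beta> / 2) /
          (pi powr (m * n * \<beta> / 2) * mgamma_neg TYPE('a) (n * \<beta> / 2) \<kappa> *
            mdet \<Sigma> powr (n * \<beta> / 2) * mdet \<Theta> powr (m * \<beta> / 2)) *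
        exp (- \<beta> * mtrace (kr_trace_arg \<Theta> \<Sigma> (x - \<mu>))) *
        gen_power \<kappa> (minv (kr_power_arg \<Theta> \<Sigma> (x - \<mu>)))))"
proof -
  let ?gram = "\<lambda>z :: 'a ^ 'm::{finite,wellorder} ^ 'n::{finite,wellorder}. mstar z \<star> z"
  have \<beta>: "\<beta> > 0" by (simp add: \<beta>_def)
  have factor: "(\<lambda>z. C * exp (- \<beta> * mtrace (?gram z)) * q (?gram z)) \<in> borel_measurable borel"
    if q: "q \<in> borel_measurable borel" for C q
  proof -
    have gram: "?gram \<in> borel_measurable borel"
      by (intro borel_measurable_continuous_onI continuous_intros)
    have "(\<lambda>z. mtrace (?gram z)) \<in> borel_measurable borel"
      unfolding mtrace_def nda_Re_def
      by (intro borel_measurable_continuous_onI continuous_intros)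
    then show ?thesis
      using measurable_compose[OF gram q]
      by (intro borel_measurable_times borel_measurable_exp borel_measurable_const measurable_compose[OF _ borel_measurable_exp])
  qed
  note image = has_density_on_triangular_image[OF assms(6-8)]
  note args = kr_power_arg_of_image[OF assms(8,7)] mtrace_kr_trace_arg_of_image[OF assms(8,7)]
  have rearrange: "b * d * G / (P * \<Gamma> * s * t) * E * q = b * G / (P * \<Gamma>) * E * (d * q) / (s * t)"
    for b d G P \<Gamma> s t E q :: real
    by (simp add: divide_inverse mult_ac)
  show ?thesis
    unfolding X_def
  proof (intro conjI impI; elim conjE)
    assume "spherical_kotz_riesz_I M \<kappa> Z"
    then have "has_density_on M Z full_rank_distinct (\<lambda>z.
        \<beta> powr (m * n * \<beta> / 2) * mgamma TYPE('a) TYPE('m) (n * \<beta> / 2) /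
          (pi powr (m * n * \<beta> / 2) * mgamma_pos TYPE('a) (n * \<beta> / 2) \<kappa>) *
        exp (- \<beta> * mtrace (?gram z)) * gen_power \<kappa> (\<beta> *\<^sub>R ?gram z))"
      unfolding spherical_kotz_riesz_I_def Let_def \<beta>_def m_def n_def by blast
    then show "has_density_on M (\<lambda>w. \<mu> + mstar (chol \<Theta>) \<star> Z w \<star> chol \<Sigma>) full_rank_distinct (\<lambda>x.
        \<beta> powr (m * n * \<beta> / 2 + (\<Sum>i\<in>UNIV. \<kappa> $ i)) * mgamma TYPE('a) TYPE('m) (n * \<beta> / 2) /
          (pi powr (m * n * \<beta> / 2) * mgamma_pos TYPE('a) (n * \<beta> / 2) \<kappa> *
            mdet \<Sigma> powr (n * \<beta> / 2) * mdet \<Theta> powr (m * \<beta> / 2)) *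
        exp (- \<beta> * mtrace (kr_trace_arg \<Theta> \<Sigma> (x - \<mu>))) *
        gen_power \<kappa> (kr_power_arg \<Theta> \<Sigma> (x - \<mu>)))"
    proof (rule image)
      have "(\<lambda>A :: 'a ^ 'm::{finite,wellorder} ^ 'm::{finite,wellorder}. gen_power \<kappa> (\<beta> *\<^sub>R A)) \<in> borel_measurable borel"
        by (intro measurable_compose[OF _ borel_measurable_gen_power]
            borel_measurable_continuous_onI continuous_intros)
      then show "(\<lambda>z. \<beta> powr (m * n * \<beta> / 2) * mgamma TYPE('a) TYPE('m) (n * \<beta> / 2) /
          (pi powr (m * n * \<beta> / 2) * mgamma_pos TYPE('a) (n * \<beta> / 2) \<kappa>) *
        exp (- \<beta> * mtrace (?gram z)) * gen_power \<kappa> (\<beta> *\<^sub>R ?gram z)) \<in> borel_measurable borel"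
        by (rule factor)
      show "\<beta> powr (m * n * \<beta> / 2 + (\<Sum>i\<in>UNIV. \<kappa> $ i)) * mgamma TYPE('a) TYPE('m) (n * \<beta> / 2) /
          (pi powr (m * n * \<beta> / 2) * mgamma_pos TYPE('a) (n * \<beta> / 2) \<kappa> *
            mdet \<Sigma> powr (n * \<beta> / 2) * mdet \<Theta> powr (m * \<beta> / 2)) *
        exp (- \<beta> * mtrace (kr_trace_arg \<Theta> \<Sigma> (\<mu> + mstar (chol \<Theta>) \<star> z \<star> chol \<Sigma> - \<mu>))) *
        gen_power \<kappa> (kr_power_arg \<Theta> \<Sigma> (\<mu> + mstar (chol \<Theta>) \<star> z \<star> chol \<Sigma> - \<mu>)) =
        \<beta> powr (m * n * \<beta> / 2) * mgamma TYPE('a) TYPE('m) (n * \<beta> / 2) /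
          (pi powr (m * n * \<beta> / 2) * mgamma_pos TYPE('a) (n * \<beta> / 2) \<kappa>) *
        exp (- \<beta> * mtrace (?gram z)) * gen_power \<kappa> (\<beta> *\<^sub>R ?gram z) /
        (mdet \<Sigma> powr (real CARD('n) * real DIM('a) / 2) * mdet \<Theta> powr (real CARD('m) * real DIM('a) / 2))" for z
        unfolding add_diff_cancel_left' args gen_power_scaleR[OF \<beta>] powr_add rearrange
        by (simp only: \<beta>_def m_def n_def)
    qed
  next
    assume "spherical_kotz_riesz_II M \<kappa> Z"
    then have "has_density_on M Z full_rank_distinct (\<lambda>z.
        \<beta> powr (m * n * \<beta> / 2) * mgamma TYPE('a) TYPE('m) (n * \<beta> / 2) /
          (pi powr (m * n * \<beta> / 2) * mgamma_neg TYPE('a) (n * \<beta> / 2) \<kappa>) *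
        exp (- \<beta> * mtrace (?gram z)) * gen_power \<kappa> (minv (\<beta> *\<^sub>R ?gram z)))"
      unfolding spherical_kotz_riesz_II_def Let_def \<beta>_def m_def n_def by blast
    then show "has_density_on M (\<lambda>w. \<mu> + mstar (chol \<Theta>) \<star> Z w \<star> chol \<Sigma>) full_rank_distinct (\<lambda>x.
        \<beta> powr (m * n * \<beta> / 2 - (\<Sum>i\<in>UNIV. \<kappa> $ i)) * mgamma TYPE('a) TYPE('m) (n * \<beta> / 2) /
          (pi powr (m * n * \<beta> / 2) * mgamma_neg TYPE('a) (n * \<beta> / 2) \<kappa> *
            mdet \<Sigma> powr (n * \<beta> / 2) * mdet \<Theta> powr (m * \<beta> / 2)) *
        exp (- \<beta> * mtrace (kr_trace_arg \<Theta> \<Sigma> (x - \<mu>))) *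
        gen_power \<kappa> (minv (kr_power_arg \<Theta> \<Sigma> (x - \<mu>))))"
    proof (rule image)
      have "(\<lambda>A :: 'a ^ 'm::{finite,wellorder} ^ 'm::{finite,wellorder}. gen_power \<kappa> (minv (\<beta> *\<^sub>R A))) \<in> borel_measurable borel"
        by (intro measurable_compose[OF _ borel_measurable_gen_power] measurable_compose[OF _ borel_measurable_minv]
            borel_measurable_continuous_onI continuous_intros)
      then show "(\<lambda>z. \<beta> powr (m * n * \<beta> / 2) * mgamma TYPE('a) TYPE('m) (n * \<beta> / 2) /
          (pi powr (m * n * \<beta> / 2) * mgamma_neg TYPE('a) (n * \<beta> / 2) \<kappa>) *
        exp (- \<beta> * mtrace (?gram z)) * gen_power \<kappa> (minv (\<beta> *\<^sub>R ?gram z))) \<in> borel_measurable borel"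
        by (rule factor)
      have "gen_power \<kappa> (minv (\<beta> *\<^sub>R A)) = \<beta> powr (- (\<Sum>i\<in>UNIV. \<kappa> $ i)) * gen_power \<kappa> (minv A)"
        for A :: "'a ^ 'm::{finite,wellorder} ^ 'm::{finite,wellorder}"
        using \<beta> by (simp add: minv_scaleR gen_power_scaleR powr_divide powr_minus_divide)
      note scale = this
      show "\<beta> powr (m * n * \<beta> / 2 - (\<Sum>i\<in>UNIV. \<kappa> $ i)) * mgamma TYPE('a) TYPE('m) (n * \<beta> / 2) /
          (pi powr (m * n * \<beta> / 2) * mgamma_neg TYPE('a) (n * \<beta> / 2) \<kappa> *
            mdet \<Sigma> powr (n * \<beta> / 2) * mdet \<Theta> powr (m * \<beta> / 2)) *
        exp (- \<beta> * mtrace (kr_trace_arg \<Theta> \<Sigma> (\<mu> + mstar (chol \<Theta>) \<star> z \<star> chol \<Sigma> - \<mu>))) *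
        gen_power \<kappa> (minv (kr_power_arg \<Theta> \<Sigma> (\<mu> + mstar (chol \<Theta>) \<star> z \<star> chol \<Sigma> - \<mu>))) =
        \<beta> powr (m * n * \<beta> / 2) * mgamma TYPE('a) TYPE('m) (n * \<beta> / 2) /
          (pi powr (m * n * \<beta> / 2) * mgamma_neg TYPE('a) (n * \<beta> / 2) \<kappa>) *
        exp (- \<beta> * mtrace (?gram z)) * gen_power \<kappa> (minv (\<beta> *\<^sub>R ?gram z)) /
        (mdet \<Sigma> powr (real CARD('n) * real DIM('a) / 2) * mdet \<Theta> powr (real CARD('m) * real DIM('a) / 2))" for z
        unfolding add_diff_cancel_left' args scale diff_conv_add_uminus[of "m * n * \<beta> / 2"] powr_add rearrange
        by (simp only: \<beta>_def m_def n_def)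
    qed
  qed
qed

end
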